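(* Let $X\subset\mathbb{Z}^2$ be a thick convex digital disk with bounding curve $S$, where $S$ is a bounding curve with respect to which $X$ is convex and thick. Let $A_1$ be the set of points $x\in S$ such that $x$ is an endpoint of a maximal horizontal or a maximal vertical edge of $S$. Let $A_2$ be the union of the slanted line segments in $S$. Then $A=A_1\cup A_2$ is a minimal freezing set for $(X,c_1)$.
   Context: Adjacencies. Distinct points $x=(x_1,x_2)$, $y=(y_1,y_2)$ of $\mathbb{Z}^2$ are $c_1$-adjacent if they differ by exactly 1 in exactly one coordinate and agree in the other (4-adjacency); they are $c_2$-adjacent if they differ by at most 1 in each coordinate (8-adjacency). Write $x\leftrightarrow_{\kappa}y$ for $\kappa$-adjacency, $\kappa\in\{c_1,c_2\}$. A $\kappa$-path is a finite sequence in which consecutive points are equal or $\kappa$-adjacent. A set $Y$ is $\kappa$-connected if any two of its points are joined by a $\kappa$-path in $Y$; $\kappa$-components are maximal $\kappa$-connected subsets. Continuity and freezing sets. For $X\subset\mathbb{Z}^2$, a function $f:X\to X$ is $\kappa$-continuous, written $f\in C(X,\kappa)$, if $f(A)$ is $\kappa$-connected for every $\kappa$-connected $A\subset X$ (equivalently, $x\leftrightarrow_\kappa x'$ in $X$ implies that $f(x)$ and $f(x')$ are equal or $\kappa$-adjacent). $\mathrm{Fix}(f)=\{x\in X: f(x)=x\}$. A set $A\subset X$ is a freezing set for $(X,\kappa)$ if for every $f\in C(X,\kappa)$, $A\subset \mathrm{Fix}(f)$ implies $f=\mathrm{id}_X$. It is a minimal freezing set if moreover no proper subset of $A$ is a freezing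 set for $(X,\kappa)$ (equivalently, $A\setminus\{p\}$ is not a freezing set for any $p\in A$). Boundary and interior. $Bd(X)=\{x\in X:\text{ there is } y\in\mathbb{Z}^2\setminus X \text{ with } y\leftrightarrow_{c_1}x\}$ and $Int(X)=X\setminus Bd(X)$. Curves and disks. A digital line segment is a $c_2$-connected set of collinear points of $\mathbb{Z}^2$; it is horizontal, vertical, or slanted (slope $\pm1$). A $c_2$-closed curve is a $c_2$-path $\{s_i\}_{i=0}^{m-1}$, $m\ge 3$, with $s_0=s_{m-1}$ and $s_i\ne s_j$ whenever $0<|i-j|<m-1$. The line segments (edges, sides) of such a curve are the digital line segments with at least two points formed by (cyclically) consecutive points of the curve; maximal means maximal under inclusion among these. If $S$ is a $c_2$-closed curve such that $\mathbb{Z}^2\setminus S$ has exactly two $c_1$-components, one finite and the other infinite, then the union $D$ of $S$ and the finite $c_1$-component is a digital disk, and $S$ is a bounding curve of $D$. Convexity. For finite $Y\subset\mathbb{Z}^2$, $hull(Y)\subset\mathbb{R}^2$ is its Euclidean convex hull. A digital disk $X$ is convex if it has a bounding curve $S$ such that the endpoints of the maximal line segments of $S$ are the vertices of the polygon $hull(X)$; then $X$ is said to be convex with respect to $S$. Interior angles. Let $s_1,s_2$ be sides of $X$, i.e. maximal line segments of a bounding curve $S$ of $X$, with $s_1\cap s_2=\{p\}$. The interior angle of $X$ (of $S$) at $p$ is the angle formed by $s_1$, $s_2$ and $Int(X)$: if there is $q\in X\setminus(s_1\cup s_2)$ with $q\leftrightarrow_{c_2}p$, it is the angle obtained by rotating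 $s_1$ about $p$ through $q$ to reach $s_2$; otherwise it is the $45^\circ$ angle determined by $s_1$ and $s_2$. Thickness. A digital disk $X$ is thick if for some bounding curve $S$ of $X$ (then $X$ is thick with respect to $S$) both of the following hold: (1) for every slanted segment $s$ of $Bd(X)$, if $p\in s$ is not an endpoint of $s$, then there exists $c\in X$, not on the line containing $s$, such that $c\leftrightarrow_{c_2}p$ and $c$ is not $c_1$-adjacent to $p$ (so $c$ is the diagonal neighbor of $p$ in a direction perpendicular to $s$); (2) if $p$ is the vertex of a $135^\circ$ interior angle $\theta$ of $S$, then there exist $b,b'\in X$ in the interior of $\theta$ such that $b\leftrightarrow_{c_2}p$, $b$ is not $c_1$-adjacent to $p$, and $b'\leftrightarrow_{c_1}p$.
   Formalization: Convexity with respect to S additionally requires each maximal line segment of S to be a side of the polygon hull(X); this excludes bounding curves that cross themselves between lattice points, for which the claim as stated can fail. *)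

theory Defs
  imports "HOL-Analysis.Analysis"
begin

type_synonym pt = "int \<times> int"

subsection \<open>Adjacency, connectedness, continuity, freezing sets\<close>

definition c1_adj :: "pt \<Rightarrow> pt \<Rightarrow> bool" where
  "c1_adj x y \<longleftrightarrow>
     (\<bar>fst x - fst y\<bar> = 1 \<and> snd x = snd y) \<or> (fst x = fst y \<and> \<bar>snd x - snd y\<bar> = 1)"

definition c2_adj :: "pt \<Rightarrow> pt \<Rightarrow> bool" where
  "c2_adj x y \<longleftrightarrow> x \<noteq> y \<and> \<bar>fst x - fst y\<bar> \<le> 1 \<and> \<bar>snd x - snd y\<bar> \<le> 1"

definition dig_path :: "(pt \<Rightarrow> pt \<Rightarrow> bool) \<Rightarrow> pt list \<Rightarrow> bool" where
  "dig_path \<kappa> s \<longleftrightarrow> successively (\<lambda>x y. x = y \<or> \<kappa> x y) s"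

definition dig_connected :: "(pt \<Rightarrow> pt \<Rightarrow> bool) \<Rightarrow> pt set \<Rightarrow> bool" where
  "dig_connected \<kappa> Y \<longleftrightarrow>
     (\<forall>x\<in>Y. \<forall>y\<in>Y. \<exists>s. s \<noteq> [] \<and> hd s = x \<and> last s = y \<and> set s \<subseteq> Y \<and> dig_path \<kappa> s)"

definition dig_components :: "(pt \<Rightarrow> pt \<Rightarrow> bool) \<Rightarrow> pt set \<Rightarrow> pt set set" where
  "dig_components \<kappa> Y =
     {C. C \<subseteq> Y \<and> dig_connected \<kappa> C \<and>
         (\<forall>C'. C \<subseteq> C' \<and> C' \<subseteq> Y \<and> dig_connected \<kappa> C' \<longrightarrow> C' = C)}"

text \<open>A self-map of \<open>X\<close> is a total function that maps \<open>X\<close> into \<open>X\<close>; only its values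
  on \<open>X\<close> matter.\<close>

definition dig_continuous :: "pt set \<Rightarrow> (pt \<Rightarrow> pt \<Rightarrow> bool) \<Rightarrow> (pt \<Rightarrow> pt) \<Rightarrow> bool" where
  "dig_continuous X \<kappa> f \<longleftrightarrow>
     f ` X \<subseteq> X \<and> (\<forall>A. A \<subseteq> X \<and> dig_connected \<kappa> A \<longrightarrow> dig_connected \<kappa> (f ` A))"

definition Fix :: "pt set \<Rightarrow> (pt \<Rightarrow> pt) \<Rightarrow> pt set" where
  "Fix X f = {x \<in> X. f x = x}"

definition freezing_set :: "pt set \<Rightarrow> (pt \<Rightarrow> pt \<Rightarrow> bool) \<Rightarrow> pt set \<Rightarrow> bool" where
  "freezing_set X \<kappa> A \<longleftrightarrow>
     A \<subseteq> X \<and> (\<forall>f. dig_continuous X \<kappa> f \<and> A \<subseteq> Fix X f \<longrightarrow> (\<forall>x\<in>X. f x = x))"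

definition minimal_freezing_set :: "pt set \<Rightarrow> (pt \<Rightarrow> pt \<Rightarrow> bool) \<Rightarrow> pt set \<Rightarrow> bool" where
  "minimal_freezing_set X \<kappa> A \<longleftrightarrow>
     freezing_set X \<kappa> A \<and> (\<forall>B. B \<subset> A \<longrightarrow> \<not> freezing_set X \<kappa> B)"

definition Bd :: "pt set \<Rightarrow> pt set" where
  "Bd X = {x \<in> X. \<exists>y. y \<notin> X \<and> c1_adj y x}"

subsection \<open>Digital line segments, closed curves, disks\<close>

text \<open>Euclidean notions (collinearity, convex hulls, angles) are taken in the complex plane.\<close>

definition emb :: "pt \<Rightarrow> complex" where
  "emb x = Complex (of_int (fst x)) (of_int (snd x))"

definition hull_of :: "pt set \<Rightarrow> complex set" where
  "hull_of Y = convex hull (emb ` Y)"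

definition dig_segment :: "pt set \<Rightarrow> bool" where
  "dig_segment e \<longleftrightarrow> dig_connected c2_adj e \<and> collinear (emb ` e)"

definition endpoint_of :: "pt \<Rightarrow> pt set \<Rightarrow> bool" where
  "endpoint_of p e \<longleftrightarrow> p \<in> e \<and> emb p extreme_point_of hull_of e"

definition horizontal :: "pt set \<Rightarrow> bool" where
  "horizontal e \<longleftrightarrow> (\<forall>x\<in>e. \<forall>y\<in>e. snd x = snd y)"

definition vertical :: "pt set \<Rightarrow> bool" where
  "vertical e \<longleftrightarrow> (\<forall>x\<in>e. \<forall>y\<in>e. fst x = fst y)"

definition slanted :: "pt set \<Rightarrow> bool" where
  "slanted e \<longleftrightarrow>
     (\<forall>x\<in>e. \<forall>y\<in>e. snd x - snd y = fst x - fst y) \<or>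
     (\<forall>x\<in>e. \<forall>y\<in>e. snd x - snd y = - (fst x - fst y))"

text \<open>A closed curve is the list \<open>[s\<^sub>0, \<dots>, s\<^sub>m\<^sub>-\<^sub>1]\<close> with \<open>s\<^sub>0 = s\<^sub>m\<^sub>-\<^sub>1\<close>.\<close>

definition c2_closed_curve :: "pt list \<Rightarrow> bool" where
  "c2_closed_curve s \<longleftrightarrow>
     3 \<le> length s \<and> dig_path c2_adj s \<and> s ! 0 = s ! (length s - 1) \<and>
     (\<forall>i j. i < j \<and> j < length s \<and> j - i < length s - 1 \<longrightarrow> s ! i \<noteq> s ! j)"

text \<open>Since the last entry repeats the first, cyclic indexing is modulo \<open>length s - 1\<close>.\<close>

definition curve_segment :: "pt list \<Rightarrow> pt set \<Rightarrow> bool" where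
  "curve_segment s e \<longleftrightarrow>
     (\<exists>i k. e = (\<lambda>j. s ! ((i + j) mod (length s - 1))) ` {..k}) \<and>
     dig_segment e \<and> 2 \<le> card e"

definition max_curve_segment :: "pt list \<Rightarrow> pt set \<Rightarrow> bool" where
  "max_curve_segment s e \<longleftrightarrow>
     curve_segment s e \<and> (\<forall>e'. curve_segment s e' \<and> e \<subseteq> e' \<longrightarrow> e' = e)"

definition bounding_curve :: "pt set \<Rightarrow> pt list \<Rightarrow> bool" where
  "bounding_curve D s \<longleftrightarrow>
     c2_closed_curve s \<and>
     (\<exists>F U. dig_components c1_adj (- set s) = {F, U} \<and> finite F \<and> infinite U \<and> D = set s \<union> F)"

definition digital_disk :: "pt set \<Rightarrow> bool" where
  "digital_disk D \<longleftrightarrow> (\<exists>s. bounding_curve D s)"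

subsection \<open>Convexity\<close>

text \<open>The endpoints of the maximal segments are the vertices of the polygon \<open>hull_of X\<close>,
  each maximal segment being a side of that polygon. The second conjunct matters only for
  curves that cross themselves between lattice points. One such curve is
  (0,1), (1,0), (2,-1), (3,-2), (3,-1), (3,0), (3,1), (3,2), (3,3), (2,2), (1,1), (0,0), (0,1):
  it bounds a disk with hull vertices (0,0), (0,1), (3,-2), (3,3), which are exactly the
  endpoints of its maximal segments, although it follows two diagonals of the hull.\<close>

definition convex_wrt :: "pt set \<Rightarrow> pt list \<Rightarrow> bool" where
  "convex_wrt X s \<longleftrightarrow>
     bounding_curve X s \<and>
     emb ` {p. \<exists>e. max_curve_segment s e \<and> endpoint_of p e} = {v. v extreme_point_of hull_of X} \<and>
     (\<forall>e. max_curve_segment s e \<longrightarrow> hull_of e edge_of hull_of X)"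

subsection \<open>Interior angles and thickness\<close>

text \<open>An angle at a vertex is given by nonzero direction vectors \<open>u\<close>, \<open>v\<close>: it is swept out by
  rotating \<open>u\<close> counterclockwise to \<open>v\<close>.\<close>

definition angle_size :: "complex \<Rightarrow> complex \<Rightarrow> real" where
  "angle_size u v = Arg2pi (v / u)"

definition in_angle :: "complex \<Rightarrow> complex \<Rightarrow> complex \<Rightarrow> bool" where
  "in_angle u v w \<longleftrightarrow> 0 < angle_size u w \<and> angle_size u w < angle_size u v"

text \<open>A clockwise rotation from \<open>e1\<close> through \<open>q\<close> to \<open>e2\<close> is a counterclockwise one from \<open>e2\<close>
  through \<open>q\<close> to \<open>e1\<close>, and the two sides are interchangeable here. If there is no \<open>q\<close>, the
  orientation is the one in which the angle is 45 degrees.\<close>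

definition interior_angle :: "pt set \<Rightarrow> pt list \<Rightarrow> pt \<Rightarrow> complex \<Rightarrow> complex \<Rightarrow> bool" where
  "interior_angle X s p u v \<longleftrightarrow>
     (\<exists>e1 e2 a1 a2. max_curve_segment s e1 \<and> max_curve_segment s e2 \<and> e1 \<inter> e2 = {p} \<and>
        a1 \<in> e1 - {p} \<and> a2 \<in> e2 - {p} \<and> u = emb a1 - emb p \<and> v = emb a2 - emb p \<and>
        (if \<exists>q \<in> X - (e1 \<union> e2). c2_adj q p
         then \<exists>q \<in> X - (e1 \<union> e2). c2_adj q p \<and> in_angle u v (emb q - emb p)
         else angle_size u v = pi / 4))"

definition thick_wrt :: "pt set \<Rightarrow> pt list \<Rightarrow> bool" where
  "thick_wrt X s \<longleftrightarrow>
     bounding_curve X s \<and>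
     (\<forall>e p. e \<subseteq> Bd X \<and> dig_segment e \<and> 2 \<le> card e \<and> slanted e \<and> p \<in> e \<and> \<not> endpoint_of p e \<longrightarrow>
        (\<exists>c\<in>X. emb c \<notin> affine hull (emb ` e) \<and> c2_adj c p \<and> \<not> c1_adj c p)) \<and>
     (\<forall>p u v. interior_angle X s p u v \<and> angle_size u v = 3 * pi / 4 \<longrightarrow>
        (\<exists>b\<in>X. \<exists>b'\<in>X. in_angle u v (emb b - emb p) \<and> in_angle u v (emb b' - emb p) \<and>
           c2_adj b p \<and> \<not> c1_adj b p \<and> c1_adj b' p))"

end

theory Submission
  imports Defs
begin

text \<open>
  Freezing. A continuous map does not lengthen paths for the 4-adjacency, and two points of a row
  or column are joined by only one shortest path, so a map that fixes both fixes all points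
  between them (\<open>straight_path_fixed\<close>). Hence an axis-parallel edge of the curve is fixed pointwise
  once its endpoints are, the slanted edges are fixed by assumption, and a point inside the curve
  lies in its row between two points of the curve (\<open>endpoints_and_slanted_freezing\<close>).

  Minimality. Let \<open>p\<close> be a point of the set. If some other point \<open>q\<close> of \<open>X\<close> equals or is adjacent
  to every neighbour of \<open>p\<close> in \<open>X\<close>, then the map that moves \<open>p\<close> to \<open>q\<close> and fixes the rest is
  continuous, so \<open>p\<close> cannot be omitted (\<open>fold_not_freezing\<close>). Which \<open>q\<close> serves depends on the turn
  of the curve at \<open>p\<close>. In an angle of 45 degrees, or of 90 degrees between slanted sides, \<open>p\<close> has
  at most one neighbour in \<open>X\<close>. In an angle of 90 degrees between axis-parallel sides, \<open>q\<close> is the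
  diagonal neighbour of \<open>p\<close>. In an angle of 135 degrees, and in the interior of a slanted side,
  thickness provides the diagonal neighbour. A point in the interior of an axis-parallel side is
  not in the set.

  Convexity enters through the sides: the line of a maximal segment of the curve has \<open>X\<close> on one
  side and meets \<open>X\<close> exactly in that segment (\<open>max_curve_segment_side\<close>). It follows that \<open>X\<close>
  consists of all lattice points in the intersection of the half planes of its sides
  (\<open>side_polygon_eq\<close>), because a step that leaves this intersection starts on the curve. This
  criterion puts the diagonal neighbour into \<open>X\<close> at an axis-parallel right angle
  (\<open>square_corner\<close>), and a neighbour of \<open>p\<close> at an obtuse corner (\<open>obtuse_corner\<close>), which identifies
  the angle there as an interior angle of 135 degrees, so that thickness applies. All
  directions are among the eight king moves, and sidedness is expressed by the integral determinant
  \<open>cross\<close>.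
\<close>

section \<open>Digital connectedness\<close>

lemma c1_adj_sym: "c1_adj x y \<Longrightarrow> c1_adj y x"
  by (auto simp: c1_adj_def)

text \<open>The form in which connectedness is used: a property that passes along the
  adjacencies inside \<open>Y\<close> spreads from one point to all of \<open>Y\<close>.\<close>

lemma dig_connected_induct:
  assumes conn: "dig_connected \<kappa> Y" and "x \<in> Y" "x \<in> A"
    and step: "\<And>a b. a \<in> A \<Longrightarrow> a \<in> Y \<Longrightarrow> b \<in> Y \<Longrightarrow> \<kappa> a b \<Longrightarrow> b \<in> A"
  shows "Y \<subseteq> A"
proof
  fix y assume "y \<in> Y"
  with conn \<open>x \<in> Y\<close> obtain l where l: "l \<noteq> []" "hd l = x" "last l = y" "set l \<subseteq> Y" "dig_path \<kappa> l"
    unfolding dig_connected_def by blast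
  have "last l \<in> A" if "l \<noteq> []" "hd l \<in> A" "set l \<subseteq> Y" "dig_path \<kappa> l" for l
    using that
  proof (induction l)
    case (Cons a l)
    show ?case
    proof (cases "l = []")
      case False
      then have "a = hd l \<or> \<kappa> a (hd l)" "dig_path \<kappa> l" "hd l \<in> Y"
        using Cons.prems by (auto simp: dig_path_def successively_Cons)
      then show ?thesis using Cons False step[of a "hd l"] by auto
    qed (use Cons in auto)
  qed simp
  then show "y \<in> A" using l \<open>x \<in> A\<close> by auto
qed

lemma dig_connected_Union:
  assumes "\<And>C. C \<in> \<C> \<Longrightarrow> dig_connected \<kappa> C \<and> x \<in> C"
  shows "dig_connected \<kappa> (\<Union>\<C>)"
  unfolding dig_connected_def
proof (intro ballI)
  fix y z assume "y \<in> \<Union>\<C>" "z \<in> \<Union>\<C>"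
  then obtain C D where C: "C \<in> \<C>" "y \<in> C" and D: "D \<in> \<C>" "z \<in> D" by blast
  obtain l where l: "l \<noteq> []" "hd l = y" "last l = x" "set l \<subseteq> C" "dig_path \<kappa> l"
    using assms[OF C(1)] C(2) unfolding dig_connected_def by blast
  obtain l' where l': "l' \<noteq> []" "hd l' = x" "last l' = z" "set l' \<subseteq> D" "dig_path \<kappa> l'"
    using assms[OF D(1)] D(2) unfolding dig_connected_def by blast
  have "dig_path \<kappa> (l @ l')"
    using l l' by (auto simp: dig_path_def successively_append_iff)
  then show "\<exists>l. l \<noteq> [] \<and> hd l = y \<and> last l = z \<and> set l \<subseteq> \<Union>\<C> \<and> dig_path \<kappa> l"
    using l l' C D by (intro exI[of _ "l @ l'"]) auto
qed

lemma dig_connected_pair: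
  assumes "\<kappa> a b" "\<kappa> b a"
  shows "dig_connected \<kappa> {a, b}"
  unfolding dig_connected_def
proof (intro ballI)
  fix x y assume "x \<in> {a, b}" "y \<in> {a, b}"
  then show "\<exists>l. l \<noteq> [] \<and> hd l = x \<and> last l = y \<and> set l \<subseteq> {a, b} \<and> dig_path \<kappa> l"
    using assms by (intro exI[of _ "[x, y]"]) (auto simp: dig_path_def)
qed

lemma dig_connected_singleton: "dig_connected \<kappa> {a}"
  unfolding dig_connected_def
proof (intro ballI)
  fix x y assume "x \<in> {a}" "y \<in> {a}"
  then show "\<exists>l. l \<noteq> [] \<and> hd l = x \<and> last l = y \<and> set l \<subseteq> {a} \<and> dig_path \<kappa> l"
    by (intro exI[of _ "[a]"]) (simp add: dig_path_def)
qed

lemma dig_components_cover: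
  assumes "x \<in> Y"
  shows "\<exists>C \<in> dig_components \<kappa> Y. x \<in> C"
proof -
  let ?\<C> = "{C. C \<subseteq> Y \<and> dig_connected \<kappa> C \<and> x \<in> C}"
  have "dig_connected \<kappa> (\<Union>?\<C>)"
    by (rule dig_connected_Union) auto
  moreover have "x \<in> \<Union>?\<C>"
    using assms dig_connected_singleton[of \<kappa> x] by auto
  ultimately have "\<Union>?\<C> \<in> dig_components \<kappa> Y"
    unfolding dig_components_def by blast
  then show ?thesis using \<open>x \<in> \<Union>?\<C>\<close> by (rule bexI[rotated])
qed

text \<open>Otherwise \<open>C \<union> {a, b}\<close> would be a larger connected set.\<close>

lemma dig_component_closed:
  assumes "C \<in> dig_components \<kappa> Y" "a \<in> C" "b \<in> Y" "\<kappa> a b" "\<kappa> b a"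
  shows "b \<in> C"
proof -
  have "dig_connected \<kappa> (\<Union>{C, {a, b}})"
    using assms dig_connected_pair[of \<kappa> a b]
    by (intro dig_connected_Union[where x = a]) (auto simp only: dig_components_def insert_iff mem_Collect_eq empty_iff)
  moreover have "C \<subseteq> \<Union>{C, {a, b}}" "\<Union>{C, {a, b}} \<subseteq> Y"
    using assms by (auto simp: dig_components_def)
  ultimately have "\<Union>{C, {a, b}} = C"
    using assms(1) unfolding dig_components_def mem_Collect_eq by metis
  then show ?thesis by blast
qed

lemma dig_component_nonempty:
  assumes "C \<in> dig_components \<kappa> Y" "Y \<noteq> {}"
  shows "C \<noteq> {}"
proof
  assume "C = {}"
  moreover obtain y where "y \<in> Y" using assms by blast
  ultimately show False
    using assms dig_connected_singleton[of \<kappa> y] by (auto simp: dig_components_def)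
qed

section \<open>Continuity and freezing for the 4-adjacency\<close>

lemma dig_continuous_step:
  assumes "dig_continuous X c1_adj f" "x \<in> X" "y \<in> X" "c1_adj x y"
  shows "f x = f y \<or> c1_adj (f x) (f y)"
proof -
  have "dig_connected c1_adj {x, y}"
    using assms(4) c1_adj_sym by (intro dig_connected_pair)
  with assms(1-3) have conn: "dig_connected c1_adj (f ` {x, y})"
    unfolding dig_continuous_def by (simp del: image_insert)
  have "f ` {x, y} \<subseteq> {f x}" if "f x \<noteq> f y" "\<not> c1_adj (f x) (f y)"
    by (rule dig_connected_induct[OF conn, of "f x"]) (use that in auto)
  then show ?thesis by auto
qed

lemma dig_continuousI:
  assumes maps: "f ` X \<subseteq> X"
    and step: "\<And>x y. x \<in> X \<Longrightarrow> y \<in> X \<Longrightarrow> \<kappa> x y \<Longrightarrow> f x = f y \<or> \<kappa> (f x) (f y)"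
  shows "dig_continuous X \<kappa> f"
  unfolding dig_continuous_def
proof (intro conjI allI impI maps)
  fix A assume A: "A \<subseteq> X \<and> dig_connected \<kappa> A"
  show "dig_connected \<kappa> (f ` A)"
    unfolding dig_connected_def
  proof (intro ballI)
    fix x' y' assume "x' \<in> f ` A" "y' \<in> f ` A"
    then obtain x y where xy: "x \<in> A" "y \<in> A" "x' = f x" "y' = f y" by blast
    then obtain l where l: "l \<noteq> []" "hd l = x" "last l = y" "set l \<subseteq> A" "dig_path \<kappa> l"
      using A unfolding dig_connected_def by blast
    have "successively (\<lambda>x y. f x = f y \<or> \<kappa> (f x) (f y)) l"
      using l(5) unfolding dig_path_def
      by (rule successively_mono) (use l(4) A step in blast)
    then have "dig_path \<kappa> (map f l)"
      by (simp add: dig_path_def successively_map)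
    then show "\<exists>l. l \<noteq> [] \<and> hd l = x' \<and> last l = y' \<and> set l \<subseteq> f ` A \<and> dig_path \<kappa> l"
      using l xy by (intro exI[of _ "map f l"]) (auto simp: hd_map last_map)
  qed
qed

text \<open>Moving \<open>p\<close> to \<open>q\<close> and nothing else is continuous when \<open>q\<close> is within one step of all
  neighbours of \<open>p\<close>. This is the only kind of map that the minimality proof needs.\<close>

lemma fold_not_freezing:
  assumes "q \<in> X" "q \<noteq> p" "p \<in> X" "p \<notin> B"
    and nbr: "\<And>n. n \<in> X \<Longrightarrow> c1_adj n p \<Longrightarrow> n = q \<or> c1_adj n q"
  shows "\<not> freezing_set X c1_adj B"
proof
  assume fr: "freezing_set X c1_adj B"
  let ?f = "id(p := q)"
  have "dig_continuous X c1_adj ?f"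
  proof (rule dig_continuousI)
    fix x y assume "x \<in> X" "y \<in> X" "c1_adj x y"
    then show "?f x = ?f y \<or> c1_adj (?f x) (?f y)"
      using nbr[of x] nbr[of y] by (auto dest: c1_adj_sym)
  qed (use assms in auto)
  moreover have "B \<subseteq> Fix X ?f"
    using fr assms by (auto simp: freezing_set_def Fix_def)
  ultimately have "?f p = p"
    using fr \<open>p \<in> X\<close> unfolding freezing_set_def by blast
  then show False using assms by simp
qed

definition smul :: "int \<Rightarrow> pt \<Rightarrow> pt" where
  "smul k d = (k * fst d, k * snd d)"

text \<open>A continuous map does not lengthen a path, and the straight path is the only one of its
  length between two points of a row or column.\<close>

lemma straight_path_fixed:
  assumes f: "dig_continuous X c1_adj f"
    and d: "d = (1, 0) \<or> d = (0, 1)"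
    and X: "\<And>k. 0 \<le> k \<Longrightarrow> k \<le> n \<Longrightarrow> t + smul k d \<in> X"
    and ends: "f t = t" "f (t + smul n d) = t + smul n d"
    and k: "0 \<le> k" "k \<le> n"
  shows "f (t + smul k d) = t + smul k d"
proof -
  define g where "g j = f (t + smul j d)" for j
  have step: "\<bar>fst (g (j + 1)) - fst (g j)\<bar> + \<bar>snd (g (j + 1)) - snd (g j)\<bar> \<le> 1"
    if "0 \<le> j" "j + 1 \<le> n" for j
  proof -
    have "c1_adj (t + smul j d) (t + smul (j + 1) d)"
      using d by (auto simp: c1_adj_def smul_def)
    from dig_continuous_step[OF f X X this] that show ?thesis
      by (auto simp: g_def c1_adj_def)
  qed
  have lip: "\<bar>fst (g (i + int m)) - fst (g i)\<bar> + \<bar>snd (g (i + int m)) - snd (g i)\<bar> \<le> int m"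
    if "0 \<le> i" "i + int m \<le> n" for i m
    using that
  proof (induction m)
    case (Suc m)
    then show ?case using step[of "i + int m"] by (simp add: algebra_simps)
  qed simp
  have "g 0 = t" "g n = t + smul n d"
    using ends by (auto simp: g_def smul_def zero_prod_def[symmetric])
  then have "g k = t + smul k d"
    using lip[of 0 "nat k"] lip[of k "nat (n - k)"] k d
    by (auto simp: smul_def prod_eq_iff)
  then show ?thesis by (simp add: g_def)
qed

section \<open>Lattice segments\<close>

definition cross :: "pt \<Rightarrow> pt \<Rightarrow> int" where
  "cross u w = fst u * snd w - snd u * fst w"

definition king :: "pt \<Rightarrow> bool" where
  "king d \<longleftrightarrow> d \<noteq> 0 \<and> \<bar>fst d\<bar> \<le> 1 \<and> \<bar>snd d\<bar> \<le> 1"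

lemma king_cases:
  assumes "king d"
  shows "d \<in> {(1, 0), (1, 1), (0, 1), (-1, 1), (-1, 0), (-1, -1), (0, -1), (1, -1)}"
proof -
  obtain a b where d: "d = (a, b)" by (cases d)
  have "a = -1 \<or> a = 0 \<or> a = 1" "b = -1 \<or> b = 0 \<or> b = 1" "\<not> (a = 0 \<and> b = 0)"
    using assms by (auto simp: king_def d zero_prod_def)
  then show ?thesis by (auto simp: d)
qed

lemma c2_adj_iff_king: "c2_adj x y \<longleftrightarrow> king (y - x)"
  by (auto simp: c2_adj_def king_def abs_minus_commute)

lemma king_uminus: "king d \<Longrightarrow> king (- d)"
  by (auto simp: king_def)

lemma cross_simps:
  "cross u (v + w) = cross u v + cross u w" "cross u (v - w) = cross u v - cross u w"
  "cross (v + w) u = cross v u + cross w u" "cross (v - w) u = cross v u - cross w u"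
  "cross (- v) u = - cross v u" "cross u (- v) = - cross u v"
  "cross u (smul k v) = k * cross u v" "cross (smul k v) u = k * cross v u"
  "cross u u = 0"
  by (auto simp: cross_def smul_def algebra_simps)

lemma cross_zero: "cross u 0 = 0"
  by (simp add: cross_def)

lemma cross_swap: "cross u v = - cross v u"
  by (simp add: cross_def)

lemma smul_simps: "smul 0 d = 0" "smul 1 d = d" "smul (-1) d = - d"
  "smul (j + k) d = smul j d + smul k d" "smul (j - k) d = smul j d - smul k d"
  "smul (- k) d = - smul k d" "smul k (- d) = - smul k d"
  by (auto simp: smul_def prod_eq_iff algebra_simps)

text \<open>A king move has a coordinate \<open>\<plusminus>1\<close>, so a lattice vector on its line is an integral
  multiple of it.\<close>

lemma king_parallel:
  assumes "king d" "cross d w = 0"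
  shows "\<exists>k. w = smul k d"
proof -
  have "w = smul (if fst d = 0 then snd w * snd d else fst w * fst d) d"
    using king_cases[OF assms(1)] assms(2) by (auto simp: cross_def smul_def prod_eq_iff)
  then show ?thesis by blast
qed

lemma smul_inject: "king d \<Longrightarrow> smul j d = smul k d \<longleftrightarrow> j = k"
  using king_cases[of d] by (auto simp: smul_def)

lemma king_smul: "king d \<Longrightarrow> king (smul k d) \<longleftrightarrow> k = 1 \<or> k = -1"
  using king_cases[of d] by (auto simp: smul_def king_def zero_prod_def)

definition lattice_segment :: "pt \<Rightarrow> pt \<Rightarrow> int \<Rightarrow> pt set" where
  "lattice_segment t d n = (\<lambda>k. t + smul k d) ` {0..n}"

lemma lattice_segment_reverse: "lattice_segment (t + smul n d) (- d) n = lattice_segment t d n"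
proof -
  have "(\<lambda>k. t + smul n d + smul k (- d)) ` {0..n} = (\<lambda>k. t + smul k d) ` (\<lambda>k. n - k) ` {0..n}"
    unfolding image_image by (intro image_cong) (auto simp: smul_simps)
  also have "(\<lambda>k. n - k) ` {0..n} = {0..n}"
    by (auto simp: image_iff intro!: bexI[of _ "n - _"])
  finally show ?thesis by (simp add: lattice_segment_def)
qed

lemma emb_add: "emb (x + y) = emb x + emb y"
  and emb_diff: "emb (x - y) = emb x - emb y"
  and emb_inject: "emb x = emb y \<longleftrightarrow> x = y"
  and emb_zero: "emb 0 = 0"
  by (auto simp: emb_def smul_def complex_eq_iff prod_eq_iff)

lemma collinear_emb_cross:
  assumes "collinear (emb ` e)" "x \<in> e" "y \<in> e" "z \<in> e"
  shows "cross (y - x) (z - x) = 0"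
proof -
  obtain u where u: "\<And>a b. a \<in> e \<Longrightarrow> b \<in> e \<Longrightarrow> \<exists>c. emb a - emb b = c *\<^sub>R u"
    using assms(1) unfolding collinear_def by blast
  obtain c c' where c: "emb y - emb x = c *\<^sub>R u" "emb z - emb x = c' *\<^sub>R u"
    using u assms by meson
  have "real_of_int (fst y - fst x) = c * Re u" "real_of_int (snd y - snd x) = c * Im u"
    "real_of_int (fst z - fst x) = c' * Re u" "real_of_int (snd z - snd x) = c' * Im u"
    using c by (auto simp: emb_def complex_eq_iff)
  then have "real_of_int (fst y - fst x) * real_of_int (snd z - snd x) =
      real_of_int (snd y - snd x) * real_of_int (fst z - fst x)"
    by (simp only: mult_ac)
  then show ?thesis
    unfolding of_int_mult[symmetric] of_int_eq_iff by (simp add: cross_def)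
qed

text \<open>Two neighbours in \<open>e\<close> determine a direction \<open>d\<close>; collinearity puts \<open>e\<close> on the line
  through them, and connectedness makes it an interval of that line.\<close>

lemma dig_segment_lattice_segment:
  assumes e: "dig_segment e" and fin: "finite e" and card: "2 \<le> card e"
  shows "\<exists>t d n. king d \<and> 1 \<le> n \<and> e = lattice_segment t d n"
proof -
  have conn: "dig_connected c2_adj e" and col: "collinear (emb ` e)"
    using e by (auto simp: dig_segment_def)
  obtain x where x: "x \<in> e" using card by (cases "e = {}") auto
  obtain b where b: "b \<in> e" "c2_adj x b"
  proof (rule ccontr)
    assume neg: "\<not> thesis"
    have "e \<subseteq> {x}"
      by (rule dig_connected_induct[OF conn x]) (use neg that in auto)
    then have "card e \<le> 1" using card_mono[of "{x}" e] by simp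
    then show False using card by simp
  qed
  define d where "d = b - x"
  have d: "king d" using b by (simp add: d_def c2_adj_iff_king)
  have line: "\<exists>k. z = x + smul k d" if z: "z \<in> e" for z
    using king_parallel[OF d, of "z - x"] collinear_emb_cross[OF col x b(1) z]
    by (auto simp: d_def[symmetric] algebra_simps)
  define K where "K = {k. x + smul k d \<in> e}"
  have eK: "e = (\<lambda>k. x + smul k d) ` K"
    unfolding K_def using line by blast
  have "inj_on (\<lambda>k. x + smul k d) K"
    using smul_inject[OF d] by (auto simp: inj_on_def)
  then have finK: "finite K"
    using fin eK finite_image_iff by blast
  have K01: "0 \<in> K" "1 \<in> K"
    using x b by (auto simp: K_def smul_simps d_def)
  define lo hi where "lo = Min K" and "hi = Max K"
  have lohi: "lo \<in> K" "hi \<in> K" "\<And>k. k \<in> K \<Longrightarrow> lo \<le> k \<and> k \<le> hi"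
    using finK K01 Min_in[of K] Max_in[of K] by (auto simp: lo_def hi_def simp del: Min_in Max_in)
  \<comment> \<open>A step along the line changes the parameter by one, so no parameter is skipped.\<close>
  have mid: "m \<in> K" if m: "lo \<le> m" "m \<le> hi" for m
  proof (rule ccontr)
    assume "m \<notin> K"
    have "e \<subseteq> {x + smul k d |k. k < m}"
    proof (rule dig_connected_induct[OF conn])
      show "x + smul lo d \<in> e" using lohi by (simp add: K_def)
      show "x + smul lo d \<in> {x + smul k d |k. k < m}"
        using lohi \<open>m \<notin> K\<close> m by (metis (mono_tags, lifting) CollectI order_le_imp_less_or_eq)
    next
      fix a b assume "a \<in> {x + smul k d |k. k < m}" "b \<in> e" "c2_adj a b"
      then obtain k k' where "a = x + smul k d" "k < m" "b = x + smul k' d" "k' \<in> K"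
        using eK by blast
      moreover from this \<open>c2_adj a b\<close> have "king (smul (k' - k) d)"
        by (simp add: c2_adj_iff_king smul_simps)
      ultimately show "b \<in> {x + smul k d |k. k < m}"
        using king_smul[OF d] \<open>m \<notin> K\<close> by (smt (verit) mem_Collect_eq)
    qed
    moreover have "x + smul hi d \<in> e" using lohi by (simp add: K_def)
    ultimately show False using m smul_inject[OF d] by auto
  qed
  have "K = {lo..hi}"
    using mid lohi(3) unfolding set_eq_iff atLeastAtMost_iff by blast
  also have "\<dots> = (\<lambda>k. lo + k) ` {0..hi - lo}"
    by (simp add: image_add_atLeastAtMost)
  finally have K: "K = (\<lambda>k. lo + k) ` {0..hi - lo}" .
  have "e = lattice_segment (x + smul lo d) d (hi - lo)"
    unfolding eK lattice_segment_def K image_image by (simp only: smul_simps add.assoc)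
  moreover have "1 \<le> hi - lo" using lohi(3)[OF K01(1)] lohi(3)[OF K01(2)] by linarith
  ultimately show ?thesis using d by blast
qed

lemma hull_of_lattice_segment:
  assumes "0 \<le> n"
  shows "hull_of (lattice_segment t d n) = closed_segment (emb t) (emb (t + smul n d))"
proof
  have "emb (t + smul k d) \<in> closed_segment (emb t) (emb (t + smul n d))"
    if "k \<in> {0..n}" for k
  proof (cases "n = 0")
    case False
    have "emb (t + smul k d) = (1 - of_int k / of_int n) *\<^sub>R emb t + (of_int k / of_int n) *\<^sub>R emb (t + smul n d)"
      using False by (simp add: emb_def smul_def complex_eq_iff field_simps)
    then show ?thesis unfolding in_segment using that
      by (intro exI[of _ "of_int k / of_int n"]) (auto simp: divide_le_eq_1)
  qed (use that in \<open>auto simp: smul_simps\<close>)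
  then show "hull_of (lattice_segment t d n) \<subseteq> closed_segment (emb t) (emb (t + smul n d))"
    unfolding hull_of_def by (intro hull_minimal) (auto simp: lattice_segment_def)
  have "t = t + smul 0 d" by (simp add: smul_simps)
  then have "{emb t, emb (t + smul n d)} \<subseteq> emb ` lattice_segment t d n"
    using assms unfolding lattice_segment_def by auto
  then show "closed_segment (emb t) (emb (t + smul n d)) \<subseteq> hull_of (lattice_segment t d n)"
    unfolding hull_of_def segment_convex_hull by (rule hull_mono)
qed

lemma endpoint_of_lattice_segment:
  assumes "0 \<le> n"
  shows "endpoint_of p (lattice_segment t d n) \<longleftrightarrow> p = t \<or> p = t + smul n d"
proof -
  have "t = t + smul 0 d" by (simp add: smul_simps)
  then have "t \<in> lattice_segment t d n" "t + smul n d \<in> lattice_segment t d n"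
    using assms unfolding lattice_segment_def by auto
  then show ?thesis
    unfolding endpoint_of_def hull_of_lattice_segment[OF assms]
    by (auto simp: extreme_point_of_segment emb_inject)
qed

lemma not_endpoint_of_midpoint:
  assumes "p + d \<in> e" "p - d \<in> e" "d \<noteq> 0"
  shows "\<not> endpoint_of p e"
proof
  assume "endpoint_of p e"
  moreover have "emb p \<in> open_segment (emb (p + d)) (emb (p - d))"
  proof -
    have "p + d \<noteq> p - d" "emb d \<noteq> 0"
      using assms(3) emb_inject[of d 0] by (auto simp: prod_eq_iff emb_zero)
    then show ?thesis unfolding in_segment
      by (auto simp: emb_inject emb_add emb_diff scaleR_conv_of_real field_simps intro!: exI[of _ "1/2"])
  qed
  moreover have "emb (p + d) \<in> hull_of e" "emb (p - d) \<in> hull_of e"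
    using assms by (auto simp: hull_of_def hull_inc)
  ultimately show False
    unfolding endpoint_of_def extreme_point_of_def by blast
qed

lemma emb_in_lattice_segment:
  assumes d: "king d" and n: "0 \<le> n" and z: "emb z \<in> hull_of (lattice_segment t d n)"
  shows "z \<in> lattice_segment t d n"
proof -
  obtain r where r: "0 \<le> r" "r \<le> 1" "emb z = (1 - r) *\<^sub>R emb t + r *\<^sub>R emb (t + smul n d)"
    using z unfolding hull_of_lattice_segment[OF n] in_segment by blast
  then have eqs: "real_of_int (fst z - fst t) = r * n * fst d" "real_of_int (snd z - snd t) = r * n * snd d"
    by (auto simp: emb_def smul_def complex_eq_iff algebra_simps)
  define k where "k = (if fst d = 0 then (snd z - snd t) * snd d else (fst z - fst t) * fst d)"
  have k: "real_of_int k = r * n"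
    using king_cases[OF d] eqs by (auto simp: k_def)
  have "real_of_int (fst (z - t)) = k * fst d" "real_of_int (snd (z - t)) = k * snd d"
    using eqs k by auto
  then have "z - t = smul k d"
    unfolding smul_def prod_eq_iff fst_conv snd_conv by linarith
  moreover have "0 \<le> real_of_int k" "real_of_int k \<le> n"
    unfolding k using r n mult_left_le_one_le[of "real_of_int n" r] by auto
  ultimately show ?thesis
    unfolding lattice_segment_def by (auto intro!: image_eqI[of _ _ k] simp: algebra_simps)
qed

lemma king_in_lattice_segment:
  assumes "x \<in> lattice_segment t d n" "y \<in> lattice_segment t d n" "king d" "king (y - x)"
  shows "d = y - x \<or> d = - (y - x)"
proof -
  obtain j k where "x = t + smul j d" "y = t + smul k d"
    using assms by (auto simp: lattice_segment_def)
  then have "y - x = smul (k - j) d" by (simp add: smul_simps)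
  moreover from this have "k - j = 1 \<or> k - j = -1"
    using king_smul[OF assms(3), of "k - j"] assms(4) by simp
  ultimately show ?thesis by (metis minus_minus smul_simps(2,3))
qed

section \<open>Curves that bound a disk\<close>

locale bounded_disk =
  fixes X :: "pt set" and s :: "pt list"
  assumes bounding: "bounding_curve X s"
begin

lemma closed_curve: "c2_closed_curve s"
  using bounding by (simp add: bounding_curve_def)

lemma complement_components:
  "\<exists>U. dig_components c1_adj (- set s) = {X - set s, U} \<and> finite (X - set s) \<and> set s \<subseteq> X"
proof -
  obtain F U where FU: "dig_components c1_adj (- set s) = {F, U}" "finite F" "X = set s \<union> F"
    using bounding by (auto simp: bounding_curve_def)
  then have "F \<subseteq> - set s" by (auto simp: dig_components_def)
  then have "X - set s = F" using FU by blast
  then show ?thesis using FU by auto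
qed

lemma finite_X: "finite X" and curve_subset: "set s \<subseteq> X"
proof -
  obtain U where "finite (X - set s)" "set s \<subseteq> X" using complement_components by blast
  then show "finite X" "set s \<subseteq> X" by auto
qed

lemma inside_step:
  assumes "x \<in> X - set s" "c1_adj x w"
  shows "w \<in> X"
proof (cases "w \<in> set s")
  case False
  obtain U where "dig_components c1_adj (- set s) = {X - set s, U}"
    using complement_components by blast
  then have "X - set s \<in> dig_components c1_adj (- set s)" by blast
  from dig_component_closed[OF this assms(1)] False assms(2) c1_adj_sym show ?thesis by blast
qed (use curve_subset in blast)

lemma inside_nonempty: "\<exists>x. x \<in> X - set s"
proof -
  obtain U where "dig_components c1_adj (- set s) = {X - set s, U}"
    using complement_components by blast
  then have "X - set s \<in> dig_components c1_adj (- set s)" by blast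
  moreover have "infinite (UNIV :: pt set)"
    by (simp add: finite_prod)
  then have "- set s \<noteq> {}" by (metis Compl_empty_eq List.finite_set double_complement)
  ultimately show ?thesis using dig_component_nonempty by blast
qed

text \<open>This replaces the Jordan curve theorem. If \<open>P\<close> can be left only through a
  point of the curve and \<open>q \<in> P\<close> were outside, then the whole outer component would
  stay in \<open>P\<close>; together with \<open>X \<subseteq> P\<close> this makes \<open>P\<close> the whole plane.\<close>

lemma inside_if_separated:
  assumes "q \<in> P" "X \<subseteq> P" "P \<noteq> UNIV"
    and step: "\<And>z w. z \<in> P \<Longrightarrow> z \<notin> set s \<Longrightarrow> c1_adj z w \<Longrightarrow> w \<in> P"
  shows "q \<in> X"
proof (rule ccontr)
  assume q: "q \<notin> X"
  obtain U where U: "dig_components c1_adj (- set s) = {X - set s, U}"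
    using complement_components by blast
  have "q \<in> U"
    using dig_components_cover[of q "- set s" c1_adj] q U curve_subset by auto
  moreover have "U \<in> dig_components c1_adj (- set s)" using U by blast
  then have "dig_connected c1_adj U" "U \<subseteq> - set s"
    by (simp_all add: dig_components_def)
  ultimately have "U \<subseteq> P"
    using dig_connected_induct[of c1_adj U q P] assms(1) step by blast
  moreover have "- set s \<subseteq> (X - set s) \<union> U"
    using dig_components_cover[of _ "- set s" c1_adj] U by blast
  ultimately have "UNIV \<subseteq> P"
    using assms(2) curve_subset by blast
  then show False using assms(3) by blast
qed

text \<open>A ray from an inner point can leave the finite inner component only through the curve.\<close>

lemma ray_hits_curve:
  assumes x: "x \<in> X - set s" and d: "c1_adj 0 d"
  shows "\<exists>n\<ge>1. x + smul n d \<in> set s \<and> (\<forall>k. 0 \<le> k \<longrightarrow> k \<le> n \<longrightarrow> x + smul k d \<in> X)"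
proof -
  have step: "x + smul (int j) d \<in> X \<longrightarrow> x + smul (int j) d \<notin> set s \<longrightarrow> x + smul (int (Suc j)) d \<in> X" for j
  proof (intro impI)
    assume a: "x + smul (int j) d \<in> X" "x + smul (int j) d \<notin> set s"
    have "c1_adj (x + smul (int j) d) (x + smul (int (Suc j)) d)"
      using d by (auto simp: c1_adj_def smul_def algebra_simps)
    with a show "x + smul (int (Suc j)) d \<in> X" using inside_step by blast
  qed
  have "\<exists>j. x + smul (int j) d \<in> set s"
  proof (rule ccontr)
    assume neg: "\<nexists>j. x + smul (int j) d \<in> set s"
    have "x + smul (int j) d \<in> X" for j
      by (induction j) (use x neg step in \<open>auto simp: smul_simps(1)\<close>)
    then have "range (\<lambda>j. x + smul (int j) d) \<subseteq> X" by blast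
    moreover have "inj (\<lambda>j. x + smul (int j) d)"
      using d by (auto simp: inj_def c1_adj_def smul_def prod_eq_iff)
    ultimately show False
      using finite_X finite_subset range_inj_infinite by blast
  qed
  then obtain j where j: "x + smul (int j) d \<in> set s" "\<And>i. i < j \<Longrightarrow> x + smul (int i) d \<notin> set s"
    using exists_least_iff[of "\<lambda>j. x + smul (int j) d \<in> set s"] by blast
  have inX: "i \<le> j \<Longrightarrow> x + smul (int i) d \<in> X" for i
    by (induction i) (use x j step in \<open>auto simp: smul_simps(1)\<close>)
  have "x + smul k d \<in> X" if "0 \<le> k" "k \<le> int j" for k
    using inX[of "nat k"] that by auto
  moreover have "j \<noteq> 0"
  proof
    assume "j = 0"
    then show False using j(1) x by (simp add: smul_simps)
  qed
  ultimately show ?thesis using j by (intro exI[of _ "int j"]) auto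
qed

text \<open>The degenerate closed curves that go from a point to a neighbour and back bound nothing:
  an inner point sees the curve to its left, to its right and above.\<close>

lemma length_curve: "4 \<le> length s"
proof -
  obtain x where x: "x \<in> X - set s" using inside_nonempty by blast
  have "c1_adj 0 (1, 0)" "c1_adj 0 (-1, 0)" "c1_adj 0 (0, 1)"
    by (auto simp: c1_adj_def)
  then obtain i j k where ijk: "1 \<le> i" "x + smul i (1, 0) \<in> set s"
      "1 \<le> j" "x + smul j (-1, 0) \<in> set s" "1 \<le> k" "x + smul k (0, 1) \<in> set s"
    using ray_hits_curve[OF x] by meson
  define l where "l = [x + smul i (1, 0), x + smul j (-1, 0), x + smul k (0, 1)]"
  have "distinct l"
    using ijk by (auto simp: l_def smul_def)
  have "set s \<subseteq> set (tl s)"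
  proof -
    have len: "3 \<le> length s" and "s ! 0 = s ! (length s - 1)"
      using closed_curve by (auto simp: c2_closed_curve_def)
    moreover have "s \<noteq> []" using len by auto
    ultimately have "hd s = last s"
      by (simp add: hd_conv_nth last_conv_nth)
    moreover obtain a l where al: "s = a # l" using len by (cases s) auto
    moreover have "l \<noteq> []" using len al by auto
    ultimately show ?thesis using last_in_set[of l] by auto
  qed
  moreover have "set l \<subseteq> set s" using ijk by (simp add: l_def)
  ultimately have "card (set l) \<le> card (set (tl s))" by (intro card_mono) auto
  also have "\<dots> \<le> length (tl s)" by (rule card_length)
  finally show ?thesis
    using distinct_card[OF \<open>distinct l\<close>] by (simp add: l_def)
qed

lemma curve_segment_subset:
  assumes "curve_segment s e"
  shows "e \<subseteq> set s"
proof -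
  obtain i k where e: "e = (\<lambda>j. s ! ((i + j) mod (length s - 1))) ` {..k}"
    using assms by (auto simp: curve_segment_def)
  have "(i + j) mod (length s - 1) < length s" for j
    using length_curve mod_less_divisor[of "length s - 1" "i + j"] by linarith
  then show ?thesis unfolding e by auto
qed

lemma curve_segment_in_max:
  assumes "curve_segment s e"
  obtains e' where "max_curve_segment s e'" "e \<subseteq> e'"
proof -
  have "finite {e. curve_segment s e}"
    by (rule finite_subset[of _ "Pow (set s)"]) (use curve_segment_subset in auto)
  from finite_has_maximal2[OF this, of e] assms that show ?thesis
    unfolding max_curve_segment_def by (metis mem_Collect_eq)
qed

lemma max_curve_segment_lattice:
  assumes "max_curve_segment s e"
  obtains t d n where "king d" "1 \<le> n" "e = lattice_segment t d n"
proof -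
  have e: "curve_segment s e" using assms by (simp add: max_curve_segment_def)
  then have "finite e" using curve_segment_subset finite_subset by blast
  with e show ?thesis using dig_segment_lattice_segment[of e] that
    by (auto simp: curve_segment_def)
qed

lemma consecutive_points:
  assumes "i < length s - 1"
  defines "a \<equiv> s ! i" and "b \<equiv> s ! ((i + 1) mod (length s - 1))"
  shows "c2_adj a b" "curve_segment s {a, b}"
proof -
  have b: "b = s ! Suc i"
    using assms closed_curve by (cases "Suc i = length s - 1") (auto simp: c2_closed_curve_def)
  have "a \<noteq> b"
  proof -
    have "i < Suc i \<and> Suc i < length s \<and> Suc i - i < length s - 1"
      using length_curve assms(1) by auto
    then show ?thesis
      using closed_curve unfolding a_def b c2_closed_curve_def by blast
  qed
  moreover have "a = b \<or> c2_adj a b"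
    using closed_curve assms(1) unfolding a_def b c2_closed_curve_def dig_path_def
    by (auto simp: successively_conv_nth)
  ultimately show adj: "c2_adj a b" by blast
  have "{..1::nat} = {0, 1}" by auto
  then have "{a, b} = (\<lambda>j. s ! ((i + j) mod (length s - 1))) ` {..1}"
    using assms(1) by (simp add: a_def b_def)
  moreover have "dig_connected c2_adj {a, b}"
    using adj by (intro dig_connected_pair) (auto simp: c2_adj_def abs_minus_commute)
  then have "dig_segment {a, b}" by (simp add: dig_segment_def)
  moreover have "2 \<le> card {a, b}" using \<open>a \<noteq> b\<close> by simp
  ultimately show "curve_segment s {a, b}"
    unfolding curve_segment_def by blast
qed

lemma curve_neighbours:
  assumes "p \<in> set s"
  obtains n1 n2 where "n1 \<noteq> n2" "king (n1 - p)" "king (n2 - p)"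
    "curve_segment s {p, n1}" "curve_segment s {p, n2}"
proof -
  let ?m = "length s - 1"
  have m: "3 \<le> ?m" using length_curve by simp
  obtain i where i: "i < ?m" "p = s ! i"
  proof -
    obtain i where "i < length s" "p = s ! i" using assms by (metis in_set_conv_nth)
    moreover have "s ! 0 = s ! ?m" using closed_curve by (simp add: c2_closed_curve_def)
    ultimately show ?thesis using that[of i] that[of 0] m by (cases "i = ?m") auto
  qed
  define j where "j = (if i = 0 then ?m - 1 else i - 1)"
  define k where "k = (i + 1) mod ?m"
  have j: "j < ?m" "(j + 1) mod ?m = i" 
    using i m by (cases i; auto simp: j_def Suc_diff_Suc numeral_eq_Suc)+
  have k: "k < ?m" "k \<noteq> j" using i m
    by (auto simp: j_def k_def mod_Suc split: if_splits)
  have "s ! a \<noteq> s ! b" if "a < b" "b < ?m" for a b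
  proof -
    have "a < b \<and> b < length s \<and> b - a < length s - 1" using that by auto
    then show ?thesis using closed_curve unfolding c2_closed_curve_def by blast
  qed
  then have "s ! k \<noteq> s ! j" using j k by (metis linorder_neqE_nat)
  moreover have "c2_adj p (s ! k)" "curve_segment s {p, s ! k}"
    using consecutive_points[OF i(1)] i(2) by (auto simp: k_def)
  moreover have "c2_adj (s ! j) p" "curve_segment s {s ! j, p}"
    using consecutive_points[OF j(1)] j(2) i(2) by auto
  then have "c2_adj p (s ! j)" "curve_segment s {p, s ! j}"
    by (auto simp: c2_adj_def abs_minus_commute insert_commute)
  ultimately show ?thesis using that by (simp add: c2_adj_iff_king)
qed

section \<open>The freezing property\<close>

text \<open>The points of the curve are fixed first: a point on a slanted pair of the curve belongs to
  \<open>A2\<close>, and any other lies between the two endpoints of an axis-parallel edge. An inner point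
  then lies between two points of the curve in its row.\<close>

lemma endpoints_and_slanted_freezing:
  assumes A1: "A1 = {x \<in> set s. \<exists>e. max_curve_segment s e \<and> (horizontal e \<or> vertical e) \<and> endpoint_of x e}"
    and A2: "A2 = \<Union> {e. curve_segment s e \<and> slanted e}"
  shows "freezing_set X c1_adj (A1 \<union> A2)"
  unfolding freezing_set_def
proof (intro conjI allI impI)
  show "A1 \<union> A2 \<subseteq> X"
    using A1 A2 curve_segment_subset curve_subset by blast
  fix f assume "dig_continuous X c1_adj f \<and> A1 \<union> A2 \<subseteq> Fix X f"
  then have f: "dig_continuous X c1_adj f" and fixA: "\<And>x. x \<in> A1 \<union> A2 \<Longrightarrow> f x = x"
    by (auto simp: Fix_def)
  have fixS: "f p = p" if p: "p \<in> set s" for p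
  proof -
    obtain n1 where n1: "king (n1 - p)" "curve_segment s {p, n1}"
      using curve_neighbours[OF p] by blast
    show ?thesis
    proof (cases "slanted {p, n1}")
      case True
      then show ?thesis using n1 A2 by (intro fixA) blast
    next
      case False
      obtain e where e: "max_curve_segment s e" "{p, n1} \<subseteq> e"
        using curve_segment_in_max[OF n1(2)] by blast
      obtain t d n where tdn: "king d" "1 \<le> n" "e = lattice_segment t d n"
        using max_curve_segment_lattice[OF e(1)] by blast
      have "n1 - p \<in> {(1, 0), (0, 1), (-1, 0), (0, -1)}"
        using king_cases[OF n1(1)] False by (auto simp: slanted_def prod_eq_iff)
      moreover have "d = n1 - p \<or> d = - (n1 - p)"
        by (rule king_in_lattice_segment) (use e tdn n1 in auto)
      ultimately have "d \<in> {(1, 0), (0, 1), (-1, 0), (0, -1)}"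
        by (elim disjE insertE emptyE; simp add: prod_eq_iff)
      then obtain t' d' where td': "d' = (1, 0) \<or> d' = (0, 1)" "e = lattice_segment t' d' n"
      proof (cases "d = (1, 0) \<or> d = (0, 1)")
        case False
        then have "- d = (1, 0) \<or> - d = (0, 1)"
          using \<open>d \<in> _\<close> by auto
        then show ?thesis
          using that[of "- d" "t + smul n d"] tdn(3) lattice_segment_reverse by simp
      qed (use that tdn in blast)
      have eS: "e \<subseteq> set s"
        using e(1) curve_segment_subset by (auto simp: max_curve_segment_def)
      have hv: "horizontal e \<or> vertical e"
        using td' by (auto simp: horizontal_def vertical_def lattice_segment_def smul_def)
      have "x \<in> A1" if "endpoint_of x e" for x
        using e(1) hv that eS unfolding A1 by (auto simp: endpoint_of_def)
      then have ends: "f t' = t'" "f (t' + smul n d') = t' + smul n d'"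
        using fixA tdn(2) td'(2) by (auto simp: endpoint_of_lattice_segment)
      obtain k where "0 \<le> k" "k \<le> n" "p = t' + smul k d'"
        using e(2) td'(2) by (auto simp: lattice_segment_def)
      moreover have "t' + smul k d' \<in> X" if "0 \<le> k" "k \<le> n" for k
      proof -
        have "t' + smul k d' \<in> e" using that td'(2) by (auto simp: lattice_segment_def)
        then show ?thesis using eS curve_subset by blast
      qed
      ultimately show ?thesis
        using straight_path_fixed[OF f td'(1) _ ends] by blast
    qed
  qed
  show "\<forall>x\<in>X. f x = x"
  proof
    fix x assume "x \<in> X"
    show "f x = x"
    proof (cases "x \<in> set s")
      case False
      then have x: "x \<in> X - set s" using \<open>x \<in> X\<close> by blast
      have "c1_adj 0 (1, 0)" "c1_adj 0 (-1, 0)" by (auto simp: c1_adj_def)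
      then obtain i j where i: "1 \<le> i" "x + smul i (1, 0) \<in> set s"
          "\<And>k. 0 \<le> k \<Longrightarrow> k \<le> i \<Longrightarrow> x + smul k (1, 0) \<in> X"
        and j: "1 \<le> j" "x + smul j (-1, 0) \<in> set s"
          "\<And>k. 0 \<le> k \<Longrightarrow> k \<le> j \<Longrightarrow> x + smul k (-1, 0) \<in> X"
        using ray_hits_curve[OF x] by meson
      define t where "t = x + smul j (-1, 0)"
      have t: "t + smul k (1, 0) = x + smul (k - j) (1, 0)" "x + smul (k - j) (1, 0) = x + smul (j - k) (-1, 0)" for k
        by (auto simp: t_def smul_def prod_eq_iff)
      have inX: "t + smul k (1, 0) \<in> X" if "0 \<le> k" "k \<le> i + j" for k
        using i(3)[of "k - j"] j(3)[of "j - k"] that t[of k] by (cases "k \<le> j") auto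
      have ends: "f t = t" "f (t + smul (i + j) (1, 0)) = t + smul (i + j) (1, 0)"
        using fixS i j unfolding t(1) by (auto simp: t_def)
      have "f (t + smul j (1, 0)) = t + smul j (1, 0)"
        by (rule straight_path_fixed[OF f _ inX ends]) (use i j in simp_all)
      then show ?thesis by (simp add: t smul_simps)
    qed (rule fixS)
  qed
qed

end

section \<open>The sides of a convex disk\<close>

lemma cross_same_line:
  assumes "p \<in> lattice_segment t d n" "q \<in> lattice_segment t d n"
  shows "cross d (z - p) = cross d (z - q)"
  using assms by (auto simp: lattice_segment_def cross_simps)

locale convex_disk = bounded_disk +
  assumes convex: "convex_wrt X s"
begin

text \<open>The vector \<open>d\<close> runs along the side in the direction that has \<open>X\<close> on its left. No orientation
  of the whole curve is chosen; every side has its own \<open>d\<close>.\<close>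

definition side :: "pt set \<Rightarrow> pt \<Rightarrow> bool" where
  "side e d \<longleftrightarrow> max_curve_segment s e \<and> king d \<and> (\<exists>t n. 1 \<le> n \<and> e = lattice_segment t d n) \<and>
     (\<forall>p\<in>e. \<forall>z\<in>X. 0 \<le> cross d (z - p) \<and> (cross d (z - p) = 0 \<longrightarrow> z \<in> e))"

lemma side_king: "side e d \<Longrightarrow> king d"
  by (simp add: side_def)

lemma side_subset: "side e d \<Longrightarrow> e \<subseteq> set s"
  using curve_segment_subset by (auto simp: side_def max_curve_segment_def)

lemma disk_not_in_lattice_segment:
  assumes "king d"
  shows "\<not> X \<subseteq> lattice_segment t d n"
proof
  assume sub: "X \<subseteq> lattice_segment t d n"
  obtain x where x: "x \<in> X - set s" using inside_nonempty by blast
  have "c1_adj x (x + (1, 0))" "c1_adj x (x + (0, 1))"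
    by (auto simp: c1_adj_def)
  then have "x + (1, 0) \<in> X" "x + (0, 1) \<in> X" "x \<in> X"
    using inside_step[OF x] x by auto
  then have "x + (1, 0) \<in> lattice_segment t d n" "x + (0, 1) \<in> lattice_segment t d n"
      "x \<in> lattice_segment t d n"
    using sub by auto
  then have "cross d (x - x) = cross d (x - (x + (1, 0)))" "cross d (x - x) = cross d (x - (x + (0, 1)))"
    using cross_same_line by blast+
  then show False
    using king_cases[OF assms] by (auto simp: cross_def)
qed

text \<open>A face of a polytope is exposed. The exposing linear functional is constant on \<open>e\<close>,
  so on lattice points it is a multiple of \<open>cross d\<close>; the multiple is not zero because \<open>X\<close> is
  not contained in a line.\<close>

lemma max_curve_segment_side:
  assumes "max_curve_segment s e"
  obtains d where "side e d"
proof -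
  obtain t d n where d: "king d" and n: "1 \<le> n" and e: "e = lattice_segment t d n"
    using max_curve_segment_lattice[OF assms] .
  have edge: "hull_of e edge_of hull_of X"
    using convex assms by (simp add: convex_wrt_def)
  have "polyhedron (hull_of X)"
    unfolding hull_of_def using finite_X by (intro polytope_imp_polyhedron polytope_convex_hull) auto
  then have "hull_of e exposed_face_of hull_of X"
    using edge by (simp add: exposed_face_of_polyhedron edge_of_def)
  then obtain a b where ab: "hull_of X \<subseteq> {x. a \<bullet> x \<le> b}" "hull_of e = hull_of X \<inter> {x. a \<bullet> x = b}"
    unfolding exposed_face_of_def by blast
  have eX: "e \<subseteq> X"
    using assms curve_segment_subset curve_subset by (auto simp: max_curve_segment_def)
  have hullX: "emb z \<in> hull_of X" if "z \<in> X" for z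
    using that by (auto simp: hull_of_def hull_inc)
  have hull_e: "emb z \<in> hull_of e \<longleftrightarrow> z \<in> e" for z
  proof
    assume "z \<in> e"
    then show "emb z \<in> hull_of e" by (auto simp: hull_of_def hull_inc)
  next
    assume "emb z \<in> hull_of e"
    then show "z \<in> e" using emb_in_lattice_segment d n e by simp
  qed
  have le: "a \<bullet> emb z \<le> b" if "z \<in> X" for z using hullX[OF that] ab(1) by blast
  have eq: "a \<bullet> emb z = b \<longleftrightarrow> z \<in> e" if "z \<in> X" for z
    using hullX[OF that] ab(2) hull_e[of z] by blast
  have "t + smul 0 d \<in> e" "t + smul 1 d \<in> e"
    using n unfolding e lattice_segment_def by auto
  then have "a \<bullet> emb (t + smul 0 d) = b" "a \<bullet> emb (t + smul 1 d) = b"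
    using eq eX by blast+
  then have ad: "a \<bullet> emb d = 0"
    by (simp add: smul_simps emb_add inner_add_right)
  define l where "l = Re a * snd d - Im a * fst d"
  define N where "N = real_of_int ((fst d)\<^sup>2 + (snd d)\<^sup>2)"
  have N: "N > 0" using king_cases[OF d] by (auto simp: N_def)
  \<comment> \<open>Lagrange's identity for the vectors \<open>a\<close>, \<open>d\<close> and \<open>z - p\<close>, where \<open>a\<close> is orthogonal to \<open>d\<close>.\<close>
  have lagrange: "N * (a \<bullet> emb z - a \<bullet> emb p) = - l * cross d (z - p)" for z p
  proof -
    have "N * (a \<bullet> emb z - a \<bullet> emb p) =
        - l * cross d (z - p) + (a \<bullet> emb d) * (emb d \<bullet> (emb z - emb p))"
      by (simp add: N_def l_def cross_def emb_def inner_complex_def power2_eq_square algebra_simps)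
    then show ?thesis by (simp add: ad)
  qed
  have sgn: "0 \<le> l * cross d (z - p)" and zero: "l * cross d (z - p) = 0 \<Longrightarrow> z \<in> e"
    if "p \<in> e" "z \<in> X" for p z
  proof -
    have p: "a \<bullet> emb p = b" using eq that(1) eX by blast
    have "N * (a \<bullet> emb z - a \<bullet> emb p) \<le> 0"
      using N le[OF that(2)] p by (intro mult_nonneg_nonpos) auto
    then show "0 \<le> l * cross d (z - p)" using lagrange[of z p] by simp
    assume "l * cross d (z - p) = 0"
    then have "N * (a \<bullet> emb z - a \<bullet> emb p) = 0" using lagrange[of z p] by simp
    then show "z \<in> e" using N p eq[OF that(2)] by simp
  qed
  have "l \<noteq> 0"
  proof
    assume "l = 0"
    then have "X \<subseteq> e" using zero[OF \<open>t + smul 0 d \<in> e\<close>] by auto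
    then show False using disk_not_in_lattice_segment[OF d] e by blast
  qed
  then consider "l > 0" | "l < 0" by linarith
  then show ?thesis
  proof cases
    case 1
    have "0 \<le> cross d (z - p) \<and> (cross d (z - p) = 0 \<longrightarrow> z \<in> e)" if "p \<in> e" "z \<in> X" for p z
      using sgn[OF that] zero[OF that] 1 by (simp add: zero_le_mult_iff)
    then show ?thesis using that[of d] assms d n e unfolding side_def by blast
  next
    case 2
    have "0 \<le> cross (- d) (z - p) \<and> (cross (- d) (z - p) = 0 \<longrightarrow> z \<in> e)" if "p \<in> e" "z \<in> X" for p z
      using sgn[OF that] zero[OF that] 2 unfolding cross_simps by (simp add: zero_le_mult_iff)
    moreover have "e = lattice_segment (t + smul n d) (- d) n"
      using e lattice_segment_reverse by simp
    ultimately show ?thesis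
      using that[of "- d"] assms king_uminus[OF d] n unfolding side_def by blast
  qed
qed

lemma side_through_pair:
  assumes "curve_segment s {p, m}" "king (m - p)"
  obtains e d where "side e d" "p \<in> e" "m \<in> e" "d = m - p \<or> d = - (m - p)"
proof -
  obtain e where e: "max_curve_segment s e" "{p, m} \<subseteq> e"
    using curve_segment_in_max[OF assms(1)] .
  obtain d where d: "side e d" using max_curve_segment_side[OF e(1)] .
  then obtain t n where "king d" "e = lattice_segment t d n" by (auto simp: side_def)
  then have "d = m - p \<or> d = - (m - p)"
    using king_in_lattice_segment[of p t d n m] e(2) assms(2) by auto
  then show ?thesis using that d e(2) by blast
qed

definition side_polygon :: "pt set" where
  "side_polygon = {z. \<forall>e d p. side e d \<longrightarrow> p \<in> e \<longrightarrow> 0 \<le> cross d (z - p)}"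

lemma side_polygonD: "z \<in> side_polygon \<Longrightarrow> side e d \<Longrightarrow> p \<in> e \<Longrightarrow> 0 \<le> cross d (z - p)"
  unfolding side_polygon_def by blast

lemma sideD: "side e d \<Longrightarrow> p \<in> e \<Longrightarrow> z \<in> X \<Longrightarrow> 0 \<le> cross d (z - p)"
  and side_line: "side e d \<Longrightarrow> p \<in> e \<Longrightarrow> z \<in> X \<Longrightarrow> cross d (z - p) = 0 \<Longrightarrow> z \<in> e"
  unfolding side_def by blast+

lemma X_subset_side_polygon: "X \<subseteq> side_polygon"
  unfolding side_polygon_def using sideD by blast

text \<open>Where \<open>X\<close> ends on a line, the curve leaves that line, and the side
  along which it leaves cuts off the rest of the ray.\<close>

lemma side_polygon_ray_end:
  assumes x: "x \<in> set s" and v: "king v" and "x - v \<in> X" "x + v \<notin> X"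
    and j: "0 \<le> j" "x + smul j v \<in> side_polygon"
  shows "j = 0"
proof -
  obtain n1 n2 where "n1 \<noteq> n2" "king (n1 - x)" "king (n2 - x)"
    "curve_segment s {x, n1}" "curve_segment s {x, n2}"
    using curve_neighbours[OF x] .
  then obtain m where m: "king (m - x)" "curve_segment s {x, m}" "m \<noteq> x - v" by metis
  then have "m \<noteq> x + v"
    using curve_segment_subset curve_subset assms(4) by blast
  obtain e d where e: "side e d" "x \<in> e" "d = m - x \<or> d = - (m - x)"
    using side_through_pair[OF m(2,1)] .
  have "0 \<le> cross d (x - v - x)" using sideD[OF e(1,2)] assms(3) by blast
  then have le: "cross d v \<le> 0" by (simp add: cross_simps)
  have "cross d v \<noteq> 0"
  proof
    assume "cross d v = 0"
    then have "cross (m - x) v = 0" using e(3) by (auto simp: cross_simps)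
    then obtain k where "v = smul k (m - x)" using king_parallel[OF m(1)] by blast
    then have "v = m - x \<or> v = - (m - x)"
      using king_smul[OF m(1), of k] v by (auto simp: smul_simps)
    then show False using m(3) \<open>m \<noteq> x + v\<close> by auto
  qed
  moreover have "0 \<le> cross d (x + smul j v - x)" using side_polygonD[OF j(2) e(1,2)] .
  then have "0 \<le> j * cross d v" by (simp add: cross_simps)
  ultimately show ?thesis using le j(1) by (auto simp: zero_le_mult_iff)
qed

lemma cross_king_c1_step:
  assumes "king d" "c1_adj z w"
  shows "\<bar>cross d z - cross d w\<bar> \<le> 1"
  using king_cases[OF assms(1)] assms(2) by (auto simp: cross_def c1_adj_def)

text \<open>The functionals \<open>cross d\<close> are integral and change by at most one in a step, so a step
  out of the polygon starts on the line of a side. On that line the polygon does not extend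
  beyond the side itself, which is part of the curve.\<close>

lemma side_polygon_step:
  assumes z: "z \<in> side_polygon" "z \<notin> set s" and w: "c1_adj z w"
  shows "w \<in> side_polygon"
proof (rule ccontr)
  assume "w \<notin> side_polygon"
  then obtain e d p where e: "side e d" "p \<in> e" "cross d (w - p) < 0"
    by (auto simp: side_polygon_def not_le)
  then obtain t n where d: "king d" and tn: "1 \<le> n" "e = lattice_segment t d n"
    by (auto simp: side_def)
  have "0 \<le> cross d (z - p)" using side_polygonD[OF z(1) e(1,2)] .
  then have "cross d (z - p) = 0"
    using e(3) cross_king_c1_step[OF d w] by (simp add: cross_simps)
  then obtain i where "z - p = smul i d" using king_parallel[OF d] by blast
  moreover obtain i' where "p = t + smul i' d" using e(2) tn by (auto simp: lattice_segment_def)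
  ultimately have zk: "z = t + smul (i + i') d" by (simp add: smul_simps algebra_simps)
  define k where "k = i + i'"
  have zk: "z = t + smul k d" using zk by (simp add: k_def)
  have mem: "t + smul i d \<in> e \<longleftrightarrow> 0 \<le> i \<and> i \<le> n" for i
    using tn smul_inject[OF d] by (auto simp: lattice_segment_def)
  have eX: "e \<subseteq> X" using side_subset[OF e(1)] curve_subset by blast
  have off: "t + smul i d \<notin> X" if "\<not> (0 \<le> i \<and> i \<le> n)" for i
  proof
    assume "t + smul i d \<in> X"
    moreover have "t \<in> e" using mem[of 0] tn by (simp add: smul_simps)
    ultimately have "t + smul i d \<in> e"
      using side_line[OF e(1)] by (simp add: cross_simps)
    then show False using mem that by blast
  qed
  have "\<not> (0 \<le> k \<and> k \<le> n)" using mem[of k] zk z(2) side_subset[OF e(1)] by blast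
  then consider "k > n" | "k < 0" by linarith
  then show False
  proof cases
    case 1
    have "k - n = 0"
    proof (rule side_polygon_ray_end)
      show "t + smul n d \<in> set s" using mem[of n] tn side_subset[OF e(1)] by auto
      show "t + smul n d - d \<in> X" using mem[of "n - 1"] tn eX by (auto simp: smul_simps algebra_simps)
      show "t + smul n d + d \<notin> X" using off[of "n + 1"] by (simp add: smul_simps algebra_simps)
      show "t + smul n d + smul (k - n) d \<in> side_polygon"
        using z(1) zk by (simp add: smul_simps algebra_simps)
    qed (use 1 d in auto)
    then show False using 1 by simp
  next
    case 2
    have "- k = 0"
    proof (rule side_polygon_ray_end)
      show "t \<in> set s" using mem[of 0] tn side_subset[OF e(1)] by (auto simp: smul_simps)
      show "t - (- d) \<in> X" using mem[of 1] tn eX by (auto simp: smul_simps)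
      show "t + - d \<notin> X" using off[of "-1"] by (simp add: smul_simps)
      show "t + smul (- k) (- d) \<in> side_polygon"
        using z(1) zk by (simp add: smul_simps)
    qed (use 2 king_uminus[OF d] in auto)
    then show False using 2 by simp
  qed
qed

text \<open>Hence a lattice point belongs to \<open>X\<close> as soon as no side cuts it off. This is what makes it
  possible to find points of \<open>X\<close> near a corner.\<close>

lemma side_polygon_eq: "side_polygon = X"
proof
  obtain x where x: "x \<in> set s" using length_curve by (cases s) auto
  then obtain m where "king (m - x)" "curve_segment s {x, m}"
    using curve_neighbours by blast
  then obtain e d where e: "side e d" "x \<in> e" using side_through_pair by blast
  \<comment> \<open>The vector \<open>d\<close> turned clockwise by a right angle points out of the polygon.\<close>
  have "cross d (x + (snd d, - fst d) - x) < 0"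
    using e(1) king_cases[of d] by (auto simp: side_def cross_def)
  then have "side_polygon \<noteq> UNIV" using side_polygonD e by (metis UNIV_I not_le)
  then show "side_polygon \<subseteq> X"
    using inside_if_separated X_subset_side_polygon side_polygon_step by blast
qed (rule X_subset_side_polygon)

end

section \<open>Angles\<close>

lemma Im_emb_divide_pos: "0 < Im (emb w / emb u) \<longleftrightarrow> 0 < cross u w"
  and Im_emb_divide_nonneg: "0 \<le> Im (emb w / emb u) \<longleftrightarrow> u = 0 \<or> 0 \<le> cross u w"
proof -
  have Im: "Im (emb w / emb u) = cross u w / ((fst u)\<^sup>2 + (snd u)\<^sup>2)"
    by (simp add: Im_divide emb_def cross_def mult.commute)
  have pos: "u \<noteq> 0 \<Longrightarrow> (0::real) < (fst u)\<^sup>2 + (snd u)\<^sup>2"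
    by (auto simp: prod_eq_iff sum_power2_gt_zero_iff)
  show "0 < Im (emb w / emb u) \<longleftrightarrow> 0 < cross u w"
    unfolding Im using pos
    by (cases "u = 0") (simp add: cross_def, simp add: zero_less_divide_iff not_less)
  show "0 \<le> Im (emb w / emb u) \<longleftrightarrow> u = 0 \<or> 0 \<le> cross u w"
    unfolding Im using pos
    by (cases "u = 0") (simp add: cross_def, simp add: zero_le_divide_iff not_less)
qed

text \<open>For angles below \<open>pi\<close>, lying between two vectors is a matter of orientation only, so no
  value of \<open>Arg2pi\<close> has to be computed.\<close>

lemma in_angle_iff_cross:
  assumes uv: "0 < cross u v"
  shows "in_angle (emb u) (emb v) (emb w) \<longleftrightarrow> 0 < cross u w \<and> 0 < cross w v"
proof
  have nz: "emb u \<noteq> 0" "emb v \<noteq> 0"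
    using uv emb_inject[of _ 0] by (auto simp: emb_zero cross_def)
  have angle: "0 < Arg2pi (emb v / emb u)" "Arg2pi (emb v / emb u) < pi"
    using uv Im_emb_divide_pos[of v u] Arg2pi_lt_pi[of "emb v / emb u"] by auto
  {
    assume "in_angle (emb u) (emb v) (emb w)"
    then have w: "0 < Arg2pi (emb w / emb u)" "Arg2pi (emb w / emb u) < Arg2pi (emb v / emb u)"
      by (auto simp: in_angle_def angle_size_def)
    then have "emb w \<noteq> 0" by auto
    then have "Arg2pi (emb v / emb w) = Arg2pi (emb v / emb u) - Arg2pi (emb w / emb u)"
      using Arg2pi_divide[of "emb w / emb u" "emb v / emb u"] nz w by simp
    then have "0 < Im (emb v / emb w)" "0 < Im (emb w / emb u)"
      using w angle Arg2pi_lt_pi[of "emb v / emb w"] Arg2pi_lt_pi[of "emb w / emb u"] by auto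
    then show "0 < cross u w \<and> 0 < cross w v" by (simp add: Im_emb_divide_pos)
  next
    assume w: "0 < cross u w \<and> 0 < cross w v"
    then have "emb w \<noteq> 0"
      using emb_inject[of w 0] by (auto simp: emb_zero cross_def)
    have wu: "0 < Arg2pi (emb w / emb u)" "Arg2pi (emb w / emb u) < pi"
      using w Im_emb_divide_pos[of w u] Arg2pi_lt_pi[of "emb w / emb u"] by auto
    have "\<not> Arg2pi (emb v / emb u) \<le> Arg2pi (emb w / emb u)"
    proof
      assume "Arg2pi (emb v / emb u) \<le> Arg2pi (emb w / emb u)"
      then have "Arg2pi (emb w / emb v) = Arg2pi (emb w / emb u) - Arg2pi (emb v / emb u)"
        using Arg2pi_divide[of "emb v / emb u" "emb w / emb u"] nz \<open>emb w \<noteq> 0\<close> by simp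
      then have "0 \<le> Im (emb w / emb v)"
        using wu angle Arg2pi_le_pi[of "emb w / emb v"] by auto
      then show False
        using Im_emb_divide_nonneg[of w v] w cross_swap[of w v] nz by (auto simp: emb_zero)
    qed
    then show "in_angle (emb u) (emb v) (emb w)"
      using wu by (simp add: in_angle_def angle_size_def)
  }
qed

lemma Arg2pi_135:
  assumes "0 < Im z" "Re z = - Im z"
  shows "Arg2pi z = 3 * pi / 4"
proof (rule Arg2pi_unique)
  have a: "3 * pi / 4 = pi - pi / 4" by simp
  have cos: "cos (3 * pi / 4) = - (sqrt 2 / 2)" and sin: "sin (3 * pi / 4) = sqrt 2 / 2"
    by (simp_all only: a cos_pi_minus sin_pi_minus cos_45 sin_45)
  have "sqrt 2 * cos (3 * pi / 4) = - 1" "sqrt 2 * sin (3 * pi / 4) = 1"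
    unfolding cos sin by simp_all
  then show "of_real (sqrt 2 * Im z) * exp (\<i> * of_real (3 * pi / 4)) = z"
    unfolding cis_conv_exp[symmetric] using assms
    by (simp add: complex_eq_iff mult.assoc mult.left_commute[of "sqrt 2"])
qed (use assms pi_gt_zero in auto)

lemma king_obtuse_cases:
  assumes "king u" "king v" "0 < cross u v" "fst u * fst v + snd u * snd v < 0"
  shows "(u, v) \<in> {((1, 0), (-1, 1)), ((1, 1), (-1, 0)), ((0, 1), (-1, -1)), ((-1, 1), (0, -1)),
      ((-1, 0), (1, -1)), ((-1, -1), (1, 0)), ((0, -1), (1, 1)), ((1, -1), (0, 1))}"
  using king_cases[OF assms(1)] king_cases[OF assms(2)] assms(3,4)
  by (elim insertE emptyE; simp add: cross_def)

lemma king_obtuse_angle: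
  assumes "king u" "king v" "0 < cross u v" "fst u * fst v + snd u * snd v < 0"
  shows "angle_size (emb u) (emb v) = 3 * pi / 4"
  unfolding angle_size_def
  by (rule Arg2pi_135)
     (use king_obtuse_cases[OF assms] in
       \<open>elim insertE emptyE; simp add: emb_def Re_divide Im_divide\<close>)+

section \<open>Folding the corners of the disk\<close>

lemma unit_cases: "c1_adj w 0 \<longleftrightarrow> w = (1, 0) \<or> w = (-1, 0) \<or> w = (0, 1) \<or> w = (0, -1)"
proof -
  obtain a b where "w = (a, b)" by (cases w)
  then show ?thesis by (auto simp: c1_adj_def)
qed

lemma c1_adj_diff: "c1_adj n p \<longleftrightarrow> c1_adj (n - p) 0"
  by (auto simp: c1_adj_def)

lemma king_axis_or_diagonal: "king d \<Longrightarrow> c1_adj d 0 \<or> \<bar>fst d\<bar> = 1 \<and> \<bar>snd d\<bar> = 1"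
  using king_cases[of d] by (auto simp: c1_adj_def)

text \<open>The units in the angle from \<open>u\<close> to \<open>v\<close>, for each of the possible sizes of this angle.\<close>

lemma unit_in_acute_angle:
  assumes "king u" "king v" "0 < cross u v" "0 < fst u * fst v + snd u * snd v"
    "c1_adj w 0" "0 \<le> cross u w" "0 \<le> cross w v"
  shows "w = (if c1_adj u 0 then u else v)"
  using king_cases[OF assms(1)] king_cases[OF assms(2)] assms(3-)
  unfolding unit_cases by (elim insertE emptyE disjE; simp add: cross_def)

lemma unit_in_right_angle:
  assumes "king u" "king v" "0 < cross u v" "fst u * fst v + snd u * snd v = 0"
    "c1_adj w 0" "0 \<le> cross u w" "0 \<le> cross w v"
  shows "if c1_adj u 0 then c1_adj v 0 \<and> (w = u \<or> w = v)
    else w = ((fst u + fst v) div 2, (snd u + snd v) div 2)"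
  using king_cases[OF assms(1)] king_cases[OF assms(2)] assms(3-)
  unfolding unit_cases by (elim insertE emptyE disjE; simp add: cross_def)

lemma unit_in_obtuse_angle:
  assumes "king u" "king v" "0 < cross u v" "fst u * fst v + snd u * snd v < 0"
    "c1_adj w 0" "0 \<le> cross u w" "0 \<le> cross w v"
    "king b" "\<not> c1_adj b 0" "0 < cross u b" "0 < cross b v"
  shows "c1_adj w b"
proof -
  have "\<bar>fst b\<bar> = 1" "\<bar>snd b\<bar> = 1"
    using king_axis_or_diagonal[OF assms(8)] assms(9) by auto
  then show ?thesis
    using king_obtuse_cases[OF assms(1-4)] assms(5-7,10,11) unfolding unit_cases
    by (elim insertE emptyE disjE; simp add: cross_def c1_adj_def)
qed

lemma unit_beside_diagonal:
  assumes "\<bar>fst d\<bar> = 1" "\<bar>snd d\<bar> = 1" "\<bar>fst c\<bar> = 1" "\<bar>snd c\<bar> = 1" "c \<noteq> d" "c \<noteq> - d"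
    "0 \<le> cross d c" "c1_adj w 0" "0 \<le> cross d w"
  shows "c1_adj w c"
proof -
  have diagonal: "x \<in> {(1, 1), (1, -1), (-1, 1), (-1, -1)}" if "\<bar>fst x\<bar> = 1" "\<bar>snd x\<bar> = 1" for x :: pt
    using that by (cases x) (auto simp: abs_if split: if_splits)
  show ?thesis
    using diagonal[OF assms(1,2)] diagonal[OF assms(3,4)] assms(5-)
    unfolding unit_cases by (elim insertE emptyE disjE; simp add: cross_def c1_adj_def)
qed

lemma sum_in_obtuse_angle:
  assumes "king u" "king v" "0 < cross u v" "fst u * fst v + snd u * snd v < 0"
  shows "c1_adj (u + v) 0" "king (u + v)"
  using king_obtuse_cases[OF assms]
  by (elim insertE emptyE; simp add: c1_adj_def king_def zero_prod_def)+

definition foldable :: "pt set \<Rightarrow> pt \<Rightarrow> bool" where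
  "foldable X p \<longleftrightarrow> (\<exists>q\<in>X. q \<noteq> p \<and> (\<forall>n\<in>X. c1_adj n p \<longrightarrow> n = q \<or> c1_adj n q))"

lemma foldableI:
  assumes "p + q \<in> X" "q \<noteq> 0"
    and "\<And>w. p + w \<in> X \<Longrightarrow> c1_adj w 0 \<Longrightarrow> w = q \<or> c1_adj w q"
  shows "foldable X p"
  unfolding foldable_def
proof (rule bexI[of _ "p + q"], intro conjI ballI impI)
  fix n assume "n \<in> X" "c1_adj n p"
  then have "n - p = q \<or> c1_adj (n - p) q"
    using assms(3)[of "n - p"] by (simp add: c1_adj_diff[of n p])
  then show "n = p + q \<or> c1_adj n (p + q)" by (auto simp: c1_adj_def)
qed (use assms in auto)

context convex_disk
begin

lemma side_cross_zero:
  assumes "side e d" "p \<in> e" "q \<in> e"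
  shows "cross d (q - p) = 0"
proof -
  obtain t n where "e = lattice_segment t d n" using assms(1) by (auto simp: side_def)
  then have "cross d (q - p) = cross d (q - q)" using cross_same_line assms by blast
  then show ?thesis by (simp add: cross_def)
qed

text \<open>Thickness, applied to \<open>p\<close> and its two neighbours on the slanted line, gives the diagonal
  neighbour of \<open>p\<close> across that line; it is adjacent to both neighbours of \<open>p\<close> that \<open>X\<close> allows.\<close>

lemma straight_foldable:
  assumes thick: "thick_wrt X s" and p: "p \<in> set s"
    and u: "king u" "p + u \<in> set s" "p - u \<in> set s" "\<not> c1_adj u 0"
    and e: "side e d" "p \<in> e" "d = u \<or> d = - u"
  shows "foldable X p"
proof -
  have on: "x \<in> e" if "x \<in> {p + u, p, p - u}" for x
  proof (rule side_line[OF e(1,2)])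
    show "x \<in> X" using that u(2,3) p curve_subset by blast
    show "cross d (x - p) = 0" using that e(3) by (auto simp: cross_simps)
  qed
  let ?e = "{p + u, p, p - u}"
  have uu: "\<bar>fst u\<bar> = 1" "\<bar>snd u\<bar> = 1" using king_axis_or_diagonal[OF u(1)] u(4) by auto
  have "x \<in> Bd X" if "x \<in> ?e" for x
  proof -
    \<comment> \<open>The horizontal unit step to the right of the slanted vector \<open>d\<close>, away from \<open>X\<close>.\<close>
    define w where "w = (snd d, 0::int)"
    have w: "cross d w < 0" "c1_adj w 0"
      using uu e(3) by (auto simp: w_def cross_def c1_adj_def abs_if split: if_splits)
    have "x + w \<notin> X"
    proof
      assume "x + w \<in> X"
      then have "0 \<le> cross d (x + w - x)" using sideD[OF e(1) on[OF that]] by blast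
      then show False using w(1) by simp
    qed
    moreover have "c1_adj (x + w) x" using w(2) by (auto simp: c1_adj_def)
    moreover have "x \<in> X" using that u(2,3) p curve_subset by blast
    ultimately show ?thesis unfolding Bd_def by blast
  qed
  moreover have "dig_segment ?e"
  proof -
    have "dig_connected c2_adj (\<Union>{{p, p + u}, {p, p - u}})"
      using u(1) king_uminus[OF u(1)]
      by (intro dig_connected_Union[where x = p])
         (auto intro!: dig_connected_pair simp: c2_adj_iff_king)
    then have "dig_connected c2_adj ?e" by (simp add: insert_commute)
    moreover have "emb p \<in> closed_segment (emb (p + u)) (emb (p - u))"
      unfolding in_segment by (intro exI[of _ "1/2"]) (simp add: emb_def complex_eq_iff field_simps)
    then have "collinear {emb (p + u), emb p, emb (p - u)}"
      by (simp add: between_imp_collinear between_mem_segment)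
    ultimately show ?thesis by (simp add: dig_segment_def)
  qed
  moreover have "2 \<le> card ?e"
  proof -
    have "card {p + u, p} = 2" using u(1) by (auto simp: king_def)
    moreover have "card {p + u, p} \<le> card ?e" by (rule card_mono) auto
    ultimately show ?thesis by simp
  qed
  moreover have "slanted ?e"
  proof -
    have "snd u = fst u \<or> snd u = - fst u" using uu by linarith
    then show ?thesis unfolding slanted_def by auto
  qed
  moreover have "\<not> endpoint_of p ?e"
    using u(1) by (intro not_endpoint_of_midpoint[of p u]) (auto simp: king_def)
  ultimately obtain c where c: "c \<in> X" "emb c \<notin> affine hull (emb ` ?e)" "c2_adj c p" "\<not> c1_adj c p"
    using thick unfolding thick_wrt_def by (metis insertI1 insertI2 subsetI)
  have "c \<notin> ?e"
  proof
    assume "c \<in> ?e"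
    then have "emb c \<in> emb ` ?e" by (rule imageI)
    then show False using c(2) hull_inc[of "emb c"] by metis
  qed
  then have off: "c - p \<noteq> u" "c - p \<noteq> - u" by (auto simp: algebra_simps)
  have c': "\<bar>fst (c - p)\<bar> = 1" "\<bar>snd (c - p)\<bar> = 1"
    using c(3,4) king_axis_or_diagonal[of "c - p"] king_uminus[of "p - c"]
    by (auto simp: c2_adj_iff_king c1_adj_diff[of c])
  have cone: "0 \<le> cross d (z - p)" if "z \<in> X" for z using sideD[OF e(1,2) that] .
  have dd: "\<bar>fst d\<bar> = 1" "\<bar>snd d\<bar> = 1" using uu e(3) by auto
  have off': "c - p \<noteq> d" "c - p \<noteq> - d" using off e(3) by (metis minus_minus)+
  show ?thesis
  proof (rule foldableI[of p "c - p"])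
    fix w assume "p + w \<in> X" "c1_adj w 0"
    then have w: "0 \<le> cross d w"
      using cone[of "p + w"] by simp
    have "c1_adj w (c - p)"
      by (rule unit_beside_diagonal[OF dd c' off' cone[OF c(1)] \<open>c1_adj w 0\<close> w])
    then show "w = c - p \<or> c1_adj w (c - p)" ..
  qed (use c c' in \<open>auto simp: c1_adj_def\<close>)
qed

text \<open>At a right angle with axis-parallel sides, the unit square spanned by \<open>u\<close> and \<open>v\<close>
  belongs to \<open>X\<close>: a side that cuts off its fourth corner would reduce \<open>X\<close> to a triangle
  without interior points.\<close>

lemma square_corner:
  assumes u: "c1_adj u 0" and v: "c1_adj v 0" and uv: "0 < cross u v"
    and X: "p \<in> X" "p + u \<in> X" "p + v \<in> X"
    and cone: "\<And>z. z \<in> X \<Longrightarrow> 0 \<le> cross u (z - p) \<and> 0 \<le> cross (z - p) v"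
  shows "p + u + v \<in> X"
proof -
  have "0 \<le> cross d (p + u + v - r)" if e: "side e d" "r \<in> e" for e d r
  proof (rule ccontr)
    assume neg: "\<not> ?thesis"
    have d: "king d" using side_king[OF e(1)] .
    define h where "h = cross d (p - r)"
    have step: "\<bar>cross d u\<bar> \<le> 1" "\<bar>cross d v\<bar> \<le> 1"
      using cross_king_c1_step[OF d u] cross_king_c1_step[OF d v] by (simp_all add: cross_zero)
    have "0 \<le> h" "0 \<le> h + cross d u" "0 \<le> h + cross d v" "h + cross d u + cross d v < 0"
      using neg sideD[OF e X(1)] sideD[OF e X(2)] sideD[OF e X(3)]
      by (auto simp: h_def cross_simps)
    with step have h: "h = 1" "cross d u = -1" "cross d v = -1" by linarith+
    obtain x where x: "x \<in> X - set s" using inside_nonempty by blast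
    have "c1_adj x (x - u)" "c1_adj x (x - v)"
      using u v by (auto simp: c1_adj_def)
    then have xX: "x - u \<in> X" "x - v \<in> X" "x \<in> X"
      using inside_step[OF x] x by auto
    have "0 \<le> cross u (x - v - p)" "0 \<le> cross (x - u - p) v"
      using cone xX by auto
    then have "1 \<le> cross u (x - p)" "1 \<le> cross (x - p) v"
      using uv by (auto simp: cross_simps)
    moreover have "0 \<le> h + cross d (x - p)"
      using sideD[OF e xX(3)] by (simp add: h_def cross_simps)
    ultimately show False
      using u v uv h unfolding unit_cases by (auto simp: cross_def)
  qed
  then have "p + u + v \<in> side_polygon" unfolding side_polygon_def by blast
  then show ?thesis by (simp add: side_polygon_eq)
qed

text \<open>Here \<open>p + u + v\<close> is a neighbour of \<open>p\<close>, so a side that cuts it off passes through \<open>p\<close>; but then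
  it also cuts off \<open>p + u\<close> or \<open>p + v\<close>.\<close>

lemma obtuse_corner:
  assumes uv: "c1_adj (u + v) 0" and X: "p \<in> X" "p + u \<in> X" "p + v \<in> X"
  shows "p + u + v \<in> X"
proof -
  have "0 \<le> cross d (p + u + v - r)" if e: "side e d" "r \<in> e" for e d r
  proof -
    have d: "king d" using side_king[OF e(1)] .
    have "\<bar>cross d u + cross d v\<bar> \<le> 1"
      using cross_king_c1_step[OF d uv] by (simp add: cross_zero cross_simps)
    then show ?thesis
      using sideD[OF e X(1)] sideD[OF e X(2)] sideD[OF e X(3)]
      by (auto simp: cross_simps)
  qed
  then have "p + u + v \<in> side_polygon" unfolding side_polygon_def by blast
  then show ?thesis by (simp add: side_polygon_eq)
qed

text \<open>The two sides confine \<open>X\<close> to the angle from \<open>u\<close> to \<open>v\<close>. In an acute angle, and in a right angle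
  with slanted sides, \<open>p\<close> has at most one neighbour in \<open>X\<close>, onto which it folds. In a right angle
  with axis-parallel sides it folds onto the opposite corner of a unit square. In an
  obtuse angle, which measures 135 degrees, thickness supplies the diagonal neighbour inside the angle.\<close>

lemma corner_foldable:
  assumes thick: "thick_wrt X s"
    and u: "king u" "curve_segment s {p, p + u}" and v: "king v" "curve_segment s {p, p + v}"
    and uv: "0 < cross u v"
  shows "foldable X p"
proof -
  have u': "king (p + u - p)" and v': "king (p + v - p)" using u(1) v(1) by simp_all
  obtain e1 d1 where e1: "side e1 d1" "p \<in> e1" "p + u \<in> e1" "d1 = p + u - p \<or> d1 = - (p + u - p)"
    using side_through_pair[OF u(2) u'] .
  obtain e2 d2 where e2: "side e2 d2" "p \<in> e2" "p + v \<in> e2" "d2 = p + v - p \<or> d2 = - (p + v - p)"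
    using side_through_pair[OF v(2) v'] .
  have X: "p \<in> X" "p + u \<in> X" "p + v \<in> X"
    using curve_segment_subset[OF u(2)] curve_segment_subset[OF v(2)] curve_subset by blast+
  have "0 \<le> cross d1 v" using sideD[OF e1(1,2) X(3)] by simp
  then have d1: "d1 = u" using e1(4) uv by (auto simp: cross_simps)
  have "0 \<le> cross d2 u" using sideD[OF e2(1,2) X(2)] by simp
  then have d2: "d2 = - v" using e2(4) uv cross_swap[of v u] by (auto simp: cross_simps)
  have cone: "0 \<le> cross u (z - p) \<and> 0 \<le> cross (z - p) v" if "z \<in> X" for z
    using sideD[OF e1(1,2) that] sideD[OF e2(1,2) that] cross_swap[of v "z - p"]
    unfolding d1 d2 by (auto simp: cross_simps)
  have cone': "0 \<le> cross u w" "0 \<le> cross w v" if "p + w \<in> X" for w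
    using cone[OF that] by auto
  have nz: "u \<noteq> 0" "v \<noteq> 0" using u v by (auto simp: king_def)
  let ?dot = "fst u * fst v + snd u * snd v"
  consider "?dot > 0" | "?dot = 0" "c1_adj u 0" | "?dot = 0" "\<not> c1_adj u 0" | "?dot < 0" by linarith
  then show ?thesis
  proof cases
    case 1
    show ?thesis
      by (rule foldableI[of p "if c1_adj u 0 then u else v"])
         (use unit_in_acute_angle[OF u(1) v(1) uv 1] cone' X nz in auto)
  next
    case 2
    have v1: "c1_adj v 0"
      using unit_in_right_angle[OF u(1) v(1) uv 2(1) 2(2)] uv 2(2) by (simp add: cross_simps)
    show ?thesis
    proof (rule foldableI[of p "u + v"])
      show "p + (u + v) \<in> X"
        using square_corner[OF 2(2) v1 uv X cone] by (simp add: add.assoc)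
      show "u + v \<noteq> 0"
      proof
        assume "u + v = 0"
        then have "cross u (u + v) = 0" by (simp add: cross_def)
        then show False using uv by (simp add: cross_simps)
      qed
      fix w assume "p + w \<in> X" "c1_adj w 0"
      then have "w = u \<or> w = v"
        using unit_in_right_angle[OF u(1) v(1) uv 2(1), of w] cone' 2(2) by auto
      then show "w = u + v \<or> c1_adj w (u + v)"
        using 2(2) v1 by (auto simp: c1_adj_def)
    qed
  next
    case 3
    let ?w = "((fst u + fst v) div 2, (snd u + snd v) div 2)"
    have one: "w = ?w" if "p + w \<in> X" "c1_adj w 0" for w
      using unit_in_right_angle[OF u(1) v(1) uv 3(1) that(2)] cone'[OF that(1)] 3(2) by simp
    show ?thesis
    proof (cases "\<exists>w. p + w \<in> X \<and> c1_adj w 0")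
      case True
      then obtain w where w: "p + w \<in> X" "c1_adj w 0" by blast
      show ?thesis
      proof (rule foldableI[OF w(1)])
        show "w \<noteq> 0" using w(2) by (auto simp: c1_adj_def)
        fix w' assume "p + w' \<in> X" "c1_adj w' 0"
        then show "w' = w \<or> c1_adj w' w" using one[of w'] one[OF w] by simp
      qed
    next
      case False
      \<comment> \<open>An isolated point may be moved anywhere.\<close>
      then show ?thesis using X nz by (intro foldableI[of p u]) auto
    qed
  next
    case 4
    have sum: "c1_adj (u + v) 0" "king (u + v)" using sum_in_obtuse_angle[OF u(1) v(1) uv 4] .
    \<comment> \<open>The point \<open>p + u + v\<close> shows that the interior angle is the one from \<open>u\<close> to \<open>v\<close>,
      not the reflex one from \<open>v\<close> to \<open>u\<close>.\<close>
    have q: "p + u + v \<in> X" using obtuse_corner[OF sum(1) X] .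
    have "e1 \<inter> e2 = {p}"
    proof -
      have "z = p" if z: "z \<in> e1" "z \<in> e2" for z
      proof -
        have "cross u (z - p) = 0" "cross v (z - p) = 0"
          using side_cross_zero[OF e1(1,2) z(1)] side_cross_zero[OF e2(1,2) z(2)]
          unfolding d1 d2 by (auto simp: cross_simps)
        moreover obtain k where "z - p = smul k u"
          using king_parallel[OF u(1) \<open>cross u (z - p) = 0\<close>] by blast
        ultimately have "z - p = 0"
          using uv cross_swap[of v u] by (auto simp: cross_simps smul_simps)
        then show ?thesis by simp
      qed
      then show ?thesis using e1 e2 by blast
    qed
    have "p + u + v \<notin> e1 \<union> e2"
      using side_cross_zero[OF e1(1,2), of "p + u + v"] side_cross_zero[OF e2(1,2), of "p + u + v"]
        uv cross_swap[of v u] unfolding d1 d2 by (auto simp: cross_simps)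
    then have q': "p + u + v \<in> X - (e1 \<union> e2)" using q by blast
    have "c2_adj (p + u + v) p"
      using king_uminus[OF sum(2)] by (simp add: c2_adj_iff_king algebra_simps)
    moreover have "in_angle (emb u) (emb v) (emb (p + u + v) - emb p)"
    proof -
      have "emb (p + u + v) - emb p = emb (u + v)" by (simp add: emb_add)
      then show ?thesis using uv by (simp add: in_angle_iff_cross cross_simps)
    qed
    moreover have "max_curve_segment s e1" "max_curve_segment s e2"
      using e1(1) e2(1) by (auto simp: side_def)
    moreover have "p + u \<in> e1 - {p}" "p + v \<in> e2 - {p}"
        "emb u = emb (p + u) - emb p" "emb v = emb (p + v) - emb p"
      using e1 e2 nz by (auto simp: emb_add)
    ultimately have "interior_angle X s p (emb u) (emb v)"
      unfolding interior_angle_def using q' \<open>e1 \<inter> e2 = {p}\<close> by meson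
    then obtain b where b: "b \<in> X" "in_angle (emb u) (emb v) (emb b - emb p)"
        "c2_adj b p" "\<not> c1_adj b p"
      using thick king_obtuse_angle[OF u(1) v(1) uv 4] unfolding thick_wrt_def by blast
    have b': "king (b - p)" "\<not> c1_adj (b - p) 0"
      using b(3,4) king_uminus[of "p - b"] by (auto simp: c2_adj_iff_king c1_adj_diff[of b])
    have "0 < cross u (b - p)" "0 < cross (b - p) v"
      using b(2) in_angle_iff_cross[OF uv, of "b - p"] by (auto simp: emb_diff)
    then show ?thesis
      using unit_in_obtuse_angle[OF u(1) v(1) uv 4 _ _ _ b'] cone' b(1) b'(1)
      by (intro foldableI[of p "b - p"]) (auto simp: king_def)
  qed
qed

text \<open>If the curve does not turn at \<open>p\<close>, then every side through \<open>p\<close> runs along the curve. So \<open>p\<close> is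
  no endpoint, and since it belongs to \<open>A1 \<union> A2\<close> the curve must be slanted there.\<close>

lemma endpoint_or_slanted_foldable:
  assumes thick: "thick_wrt X s"
    and A1: "A1 = {x \<in> set s. \<exists>e. max_curve_segment s e \<and> (horizontal e \<or> vertical e) \<and> endpoint_of x e}"
    and A2: "A2 = \<Union> {e. curve_segment s e \<and> slanted e}"
    and p: "p \<in> A1 \<union> A2"
  shows "foldable X p"
proof -
  have "A1 \<subseteq> set s" unfolding A1 by blast
  moreover have "A2 \<subseteq> set s" unfolding A2 using curve_segment_subset by blast
  ultimately have ps: "p \<in> set s" using p by blast
  obtain n1 n2 where n: "n1 \<noteq> n2" "king (n1 - p)" "king (n2 - p)"
    "curve_segment s {p, n1}" "curve_segment s {p, n2}"
    using curve_neighbours[OF ps] .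
  define u v where "u = n1 - p" and "v = n2 - p"
  have u: "king u" "curve_segment s {p, p + u}" and v: "king v" "curve_segment s {p, p + v}"
    using n by (auto simp: u_def v_def)
  consider "0 < cross u v" | "0 < cross v u" | "cross u v = 0"
    using cross_swap[of u v] by linarith
  then show ?thesis
  proof cases
    case 3
    then obtain k where "v = smul k u" using king_parallel[OF u(1)] by blast
    then have "v = u \<or> v = - u" using king_smul[OF u(1), of k] v(1) by (auto simp: smul_simps)
    then have vu: "v = - u" using n(1) by (auto simp: u_def v_def)
    have pu: "p + u \<in> set s" "p - u \<in> set s"
      using curve_segment_subset[OF u(2)] curve_segment_subset[OF v(2)] vu by auto
    \<comment> \<open>Both \<open>p + u\<close> and \<open>p - u\<close> lie on the same side of any side through \<open>p\<close>, hence on it.\<close>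
    have through: "cross d u = 0 \<and> p + u \<in> e \<and> p - u \<in> e" if e: "side e d" "p \<in> e" for e d
    proof -
      have "0 \<le> cross d (p + u - p)" "0 \<le> cross d (p - u - p)"
        using sideD[OF e] pu curve_subset by blast+
      then have "cross d u = 0" by (simp add: cross_simps)
      moreover from this have "p + u \<in> e" "p - u \<in> e"
        using side_line[OF e, of "p + u"] side_line[OF e, of "p - u"] pu curve_subset
        by (auto simp: cross_simps)
      ultimately show ?thesis by blast
    qed
    have "p \<notin> A1"
    proof
      assume "p \<in> A1"
      then obtain e where e: "max_curve_segment s e" "endpoint_of p e" unfolding A1 by blast
      obtain d where d: "side e d" using max_curve_segment_side[OF e(1)] .
      have "p \<in> e" using e(2) by (simp add: endpoint_of_def)
      from through[OF d this] show False
        using not_endpoint_of_midpoint[of p u e] e(2) u(1) by (auto simp: king_def)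
    qed
    then obtain e where e: "curve_segment s e" "slanted e" "p \<in> e" using p A2 by blast
    obtain e' where e': "max_curve_segment s e'" "e \<subseteq> e'" using curve_segment_in_max[OF e(1)] .
    obtain d where d: "side e' d" using max_curve_segment_side[OF e'(1)] .
    have "p \<in> e'" using e e' by blast
    have "\<exists>x\<in>e. x \<noteq> p"
    proof (rule ccontr)
      assume "\<not> ?thesis"
      then have "e \<subseteq> {p}" by blast
      then have "card e \<le> 1" using card_mono[of "{p}" e] by simp
      then show False using e(1) by (simp add: curve_segment_def)
    qed
    then obtain x where x: "x \<in> e" "x \<noteq> p" by blast
    have "king d" using d by (simp add: side_def)
    have "cross d (x - p) = 0" using side_cross_zero[OF d \<open>p \<in> e'\<close>] x e' by blast
    then obtain k where k: "x - p = smul k d" using king_parallel \<open>king d\<close> by blast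
    obtain j where j: "u = smul j d"
      using king_parallel[OF \<open>king d\<close>] through[OF d \<open>p \<in> e'\<close>] by blast
    then have "d = u \<or> d = - u"
      using king_smul[OF \<open>king d\<close>, of j] u(1) by (auto simp: smul_simps)
    moreover have "\<not> c1_adj d 0"
    proof
      assume "c1_adj d 0"
      have "k \<noteq> 0" using k x(2) by (auto simp: smul_simps)
      have "snd (x - p) = fst (x - p) \<or> snd (x - p) = - fst (x - p)"
        using e(2,3) x(1) by (auto simp: slanted_def)
      then show False
        using \<open>c1_adj d 0\<close> \<open>k \<noteq> 0\<close> unfolding k unit_cases by (auto simp: smul_def)
    qed
    ultimately have "\<not> c1_adj u 0" by (auto simp: c1_adj_def)
    then show ?thesis
      using straight_foldable[OF thick ps u(1) pu _ d \<open>p \<in> e'\<close> \<open>d = u \<or> d = - u\<close>] by blast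
  qed (use corner_foldable[OF thick u v] corner_foldable[OF thick v u] in blast)+
qed

end

section \<open>The minimal freezing set\<close>

theorem theorem3p7:
  fixes X :: "pt set" and s :: "pt list" and A1 A2 :: "pt set"
  assumes "digital_disk X"
    and "bounding_curve X s"
    and "convex_wrt X s"
    and "thick_wrt X s"
    and "A1 = {x \<in> set s. \<exists>e. max_curve_segment s e \<and> (horizontal e \<or> vertical e) \<and> endpoint_of x e}"
    and "A2 = \<Union> {e. curve_segment s e \<and> slanted e}"
  shows "minimal_freezing_set X c1_adj (A1 \<union> A2)"
proof -
  interpret convex_disk X s
    using assms(2,3) by unfold_locales
  have freezing: "freezing_set X c1_adj (A1 \<union> A2)"
    using endpoints_and_slanted_freezing[OF assms(5,6)] .
  have "\<not> freezing_set X c1_adj B" if B: "B \<subset> A1 \<union> A2" for B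
  proof -
    obtain p where p: "p \<in> A1 \<union> A2" "p \<notin> B" using B by blast
    then have "p \<in> X" using freezing by (auto simp: freezing_set_def)
    moreover have "foldable X p"
      using endpoint_or_slanted_foldable[OF assms(4-6) p(1)] .
    ultimately show ?thesis
      using fold_not_freezing[of _ X p B] p(2) unfolding foldable_def by blast
  qed
  with freezing show ?thesis unfolding minimal_freezing_set_def by blast
qed

end
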